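(* Let $R=\mathbb{K}[x_1,\ldots,x_n]$ be a polynomial ring over a field $\mathbb{K}$ of prime characteristic $p>0$ and let $\mathfrak{m}=(x_1,\ldots,x_n)$. Let $\mathfrak{a}$ be a non-zero proper square-free monomial ideal in $R$. Then $$\mathcal{C}^{\mathfrak{m}}(\mathfrak{a}^{(\bullet)})=\min\left\{\frac{v_{\mathfrak{p}}(x_1\cdots x_n)}{\widehat{v}_{\mathfrak{p}}(\mathfrak{a}^{(\bullet)})}:\mathfrak{p}\in\mathrm{Min}(\mathfrak{a})\right\}=\operatorname{ht}(\mathfrak{a}),$$ where $\mathrm{Min}(\mathfrak{a})$ is the set of minimal primes of $\mathfrak{a}$ and, for $\mathfrak{p}\in\mathrm{Min}(\mathfrak{a})$, $v_{\mathfrak{p}}$ is the monomial valuation defined by $v_{\mathfrak{p}}(x_1^{m_1}\cdots x_n^{m_n})=\sum_{x_i\in\mathfrak{p}}m_i$ for all monomials $x_1^{m_1}\cdots x_n^{m_n}$ in $R$.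
   Context: A valuation $v$ of the fraction field of $R$ is monomial if $v(f)=\min\{v(u):u\text{ a monomial term of }f\}$ for every non-zero $f\in R$. For an ideal $J$, $v(J)=\min\{v(f):f\in J\setminus\{0\}\}$; for a filtration of ideals $\mathfrak{a}_\bullet$, $\widehat{v}(\mathfrak{a}_\bullet)=\lim_{r\to\infty}v(\mathfrak{a}_r)/r=\inf_{r\ge 1}v(\mathfrak{a}_r)/r$. $\mathfrak{a}^{(\bullet)}=\{\mathfrak{a}^{(i)}\}_{i\ge 0}$ with $\mathfrak{a}^{(i)}=\bigcap_{\mathfrak{q}\in\operatorname{Ass}(\mathfrak{a})}(\mathfrak{a}^iR_{\mathfrak{q}}\cap R)$ the $i$-th symbolic power. $\mathfrak{m}^{[p^e]}=(x_1^{p^e},\ldots,x_n^{p^e})$, $\nu_{\mathfrak{a}_\bullet}^{\mathfrak{m}}(p^e)=\sup\{r\in\mathbb{Z}_{\ge 0}:\mathfrak{a}_r\not\subseteq\mathfrak{m}^{[p^e]}\}$, and $\mathcal{C}^{\mathfrak{m}}(\mathfrak{a}_\bullet)=\lim_{e\to\infty}\nu_{\mathfrak{a}_\bullet}^{\mathfrak{m}}(p^e)/p^e$ (which exists for $\mathfrak{a}^{(\bullet)}$). *)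

theory Defs
  imports
    "HOL-Library.Poly_Mapping"
    "HOL-Library.Extended_Real"
    "HOL-Computational_Algebra.Computational_Algebra"
    "HOL-Algebra.Ideal_Product"
    "HOL-Algebra.Algebraic_Closure_Type"
begin

section \<open>Polynomial rings and their ideals\<close>

text \<open>Polynomials are finitely supported functions from exponent vectors to coefficients, the
  variables being indexed by a finite (hence nonempty) type \<open>'n\<close>. The linear order on \<open>'n\<close>
  is what the library needs to see that the polynomial ring is an integral domain.\<close>

type_synonym ('n, 'k) mpoly = "('n \<Rightarrow>\<^sub>0 nat) \<Rightarrow>\<^sub>0 'k"

definition monom_of :: "('n \<Rightarrow>\<^sub>0 nat) \<Rightarrow> ('n, 'k::comm_ring_1) mpoly" where
  "monom_of m = Poly_Mapping.single m 1"

definition Var :: "'n \<Rightarrow> ('n, 'k::comm_ring_1) mpoly" where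
  "Var i = monom_of (Poly_Mapping.single i 1)"

text \<open>The ambient ring of an ideal, as a ring record with carrier \<^term>\<open>UNIV\<close>, so that ideals,
  prime ideals, generated ideals and products of ideals are those of HOL-Algebra.\<close>

abbreviation ring_of :: "'a::comm_ring_1 ring" where
  "ring_of \<equiv> ring_of_type_algebra"

definition ideal_power :: "'a::comm_ring_1 set \<Rightarrow> nat \<Rightarrow> 'a set" where
  "ideal_power I i = I [^]\<^bsub>ideals_set ring_of\<^esub> i"

definition squarefree_monomial_ideal :: "('n, 'k::comm_ring_1) mpoly set \<Rightarrow> bool" where
  "squarefree_monomial_ideal I \<longleftrightarrow>
     (\<exists>M. (\<forall>m\<in>M. \<forall>i. Poly_Mapping.lookup m i \<le> 1) \<and> I = Idl\<^bsub>ring_of\<^esub> (monom_of ` M))"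

text \<open>Associated primes of the module \<open>R/I\<close>: the primes that are annihilators of a residue class.\<close>

definition associated_primes :: "'a::comm_ring_1 set \<Rightarrow> 'a set set" where
  "associated_primes I = {Q. primeideal Q ring_of \<and> (\<exists>f. Q = {r. r * f \<in> I})}"

definition minimal_primes :: "'a::comm_ring_1 set \<Rightarrow> 'a set set" where
  "minimal_primes I =
     {P. primeideal P ring_of \<and> I \<subseteq> P \<and>
         (\<forall>Q. primeideal Q ring_of \<longrightarrow> I \<subseteq> Q \<longrightarrow> Q \<subseteq> P \<longrightarrow> Q = P)}"

definition prime_height :: "'a::comm_ring_1 set \<Rightarrow> enat" where
  "prime_height P =
     (SUP k \<in> {k. \<exists>Q :: nat \<Rightarrow> 'a set.
                  (\<forall>i\<le>k. primeideal (Q i) ring_of) \<and> (\<forall>i<k. Q i \<subset> Q (Suc i)) \<and> Q k = P}. enat k)"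

definition height :: "'a::comm_ring_1 set \<Rightarrow> enat" where
  "height I = (INF P \<in> {P. primeideal P ring_of \<and> I \<subseteq> P}. prime_height P)"


section \<open>Symbolic powers\<close>

text \<open>For a prime \<open>Q\<close>, the localization \<open>R\<^sub>Q\<close> as a subring of the fraction field of \<open>R\<close>;
  since \<open>0 \<in> Q\<close>, the denominators are automatically nonzero.\<close>

definition localization :: "'a::idom set \<Rightarrow> 'a fract ring" where
  "localization Q = ring_of\<lparr>carrier := {Fract f g | f g. g \<notin> Q}\<rparr>"

text \<open>\<open>I R\<^sub>Q \<inter> R\<close>\<close>

definition localize_contract :: "'a::idom set \<Rightarrow> 'a set \<Rightarrow> 'a set" where
  "localize_contract Q I = {f. to_fract f \<in> Idl\<^bsub>localization Q\<^esub> (to_fract ` I)}"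

definition symbolic_power :: "'a::idom set \<Rightarrow> nat \<Rightarrow> 'a set" where
  "symbolic_power I i = (\<Inter>Q\<in>associated_primes I. localize_contract Q (ideal_power I i))"


section \<open>The threshold with respect to the homogeneous maximal ideal\<close>

text \<open>\<open>(x\<^sub>1\<^sup>q, \<dots>, x\<^sub>n\<^sup>q)\<close>, the Frobenius power of \<open>(x\<^sub>1, \<dots>, x\<^sub>n)\<close> when \<open>q\<close> is a power of the
  characteristic.\<close>

definition frobenius_power_max :: "nat \<Rightarrow> ('n, 'k::comm_ring_1) mpoly set" where
  "frobenius_power_max q = Idl\<^bsub>ring_of\<^esub> (range (\<lambda>i. Var i ^ q))"

definition nu_max :: "(nat \<Rightarrow> ('n, 'k::comm_ring_1) mpoly set) \<Rightarrow> nat \<Rightarrow> enat" where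
  "nu_max \<aa> q = (SUP r \<in> {r. \<not> \<aa> r \<subseteq> frobenius_power_max q}. enat r)"

definition F_threshold_seq ::
    "nat \<Rightarrow> (nat \<Rightarrow> ('n, 'k::comm_ring_1) mpoly set) \<Rightarrow> nat \<Rightarrow> ereal" where
  "F_threshold_seq p \<aa> e = ereal_of_enat (nu_max \<aa> (p ^ e)) / ereal (real (p ^ e))"

definition F_threshold ::
    "nat \<Rightarrow> (nat \<Rightarrow> ('n, 'k::comm_ring_1) mpoly set) \<Rightarrow> ereal" where
  "F_threshold p \<aa> = lim (F_threshold_seq p \<aa>)"


section \<open>Monomial valuations\<close>

text \<open>A valuation is real-valued and only its values at nonzero elements are meaningful
  (the value at \<open>0\<close> stands for \<open>\<infinity>\<close> and is left arbitrary).\<close>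

definition valuation :: "('a::Fields.field \<Rightarrow> real) \<Rightarrow> bool" where
  "valuation v \<longleftrightarrow>
     (\<forall>x y. x \<noteq> 0 \<longrightarrow> y \<noteq> 0 \<longrightarrow> v (x * y) = v x + v y) \<and>
     (\<forall>x y. x \<noteq> 0 \<longrightarrow> y \<noteq> 0 \<longrightarrow> x + y \<noteq> 0 \<longrightarrow> min (v x) (v y) \<le> v (x + y))"

text \<open>The monomials of \<open>f\<close> are taken without their coefficients, so that the condition forces
  a monomial valuation to be trivial on nonzero constants.\<close>

definition monomial_valuation ::
    "(('n::{finite,linorder}, 'k::Fields.field) mpoly fract \<Rightarrow> real) \<Rightarrow> bool" where
  "monomial_valuation v \<longleftrightarrow> valuation v \<and>
     (\<forall>f. f \<noteq> 0 \<longrightarrow>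
        v (to_fract f) = Min ((\<lambda>m. v (to_fract (monom_of m))) ` Poly_Mapping.keys f))"

definition prime_valuation ::
    "('n::{finite,linorder}, 'k::Fields.field) mpoly set \<Rightarrow> ('n, 'k) mpoly fract \<Rightarrow> real" where
  "prime_valuation P =
     (SOME v. monomial_valuation v \<and>
        (\<forall>m. v (to_fract (monom_of m)) = real (\<Sum>i | Var i \<in> P. Poly_Mapping.lookup m i)))"

definition ideal_value :: "('a::idom fract \<Rightarrow> real) \<Rightarrow> 'a set \<Rightarrow> real" where
  "ideal_value v J = Inf ((\<lambda>f. v (to_fract f)) ` (J - {0}))"

definition asymptotic_value :: "('a::idom fract \<Rightarrow> real) \<Rightarrow> (nat \<Rightarrow> 'a set) \<Rightarrow> real" where
  "asymptotic_value v \<aa> = lim (\<lambda>r. ideal_value v (\<aa> r) / real r)"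


subsection \<open>Existence and uniqueness of the valuation attached to a set of variables\<close>

lemma to_fract_eq_0_iff' [simp]: "to_fract x = 0 \<longleftrightarrow> x = 0"
  by (simp add: to_fract_def Zero_fract_def eq_fract)

definition min_weight :: "('m::zero \<Rightarrow> nat) \<Rightarrow> ('m \<Rightarrow>\<^sub>0 'k::zero) \<Rightarrow> nat" where
  "min_weight W f = Min (W ` Poly_Mapping.keys f)"

lemma min_weight_le: "m \<in> Poly_Mapping.keys f \<Longrightarrow> min_weight W f \<le> W m"
  by (simp add: min_weight_def)

lemma min_weight_attained:
  assumes "f \<noteq> 0"
  obtains m where "m \<in> Poly_Mapping.keys f" "W m = min_weight W f"
proof -
  have "min_weight W f \<in> W ` Poly_Mapping.keys f"
    unfolding min_weight_def using assms by (intro Min_in) auto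
  then show ?thesis using that by auto
qed

lemma min_weight_geI:
  assumes "f \<noteq> 0" "\<And>m. m \<in> Poly_Mapping.keys f \<Longrightarrow> k \<le> W m"
  shows "k \<le> min_weight W f"
  by (rule min_weight_attained[OF assms(1), of W]) (use assms(2) in metis)

lemma split_min_weight:
  fixes f :: "'m::zero \<Rightarrow>\<^sub>0 'k::comm_ring_1"
  assumes "f \<noteq> 0"
  obtains g h where "f = g + h" "g \<noteq> 0"
    "\<And>m. m \<in> Poly_Mapping.keys g \<Longrightarrow> W m = min_weight W f"
    "\<And>m. m \<in> Poly_Mapping.keys h \<Longrightarrow> W m > min_weight W f"
proof -
  define g where "g = Abs_poly_mapping (\<lambda>m. if W m = min_weight W f then Poly_Mapping.lookup f m else 0)"
  define h where "h = Abs_poly_mapping (\<lambda>m. if W m = min_weight W f then 0 else Poly_Mapping.lookup f m)"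
  have fin: "finite {m. Poly_Mapping.lookup f m \<noteq> 0}" by simp
  have g: "Poly_Mapping.lookup g m = (if W m = min_weight W f then Poly_Mapping.lookup f m else 0)" for m
    unfolding g_def by (subst Abs_poly_mapping_inverse) (auto intro: finite_subset[OF _ fin])
  have h: "Poly_Mapping.lookup h m = (if W m = min_weight W f then 0 else Poly_Mapping.lookup f m)" for m
    unfolding h_def by (subst Abs_poly_mapping_inverse) (auto intro: finite_subset[OF _ fin])
  show ?thesis
  proof (rule that[of g h])
    show "f = g + h"
      by (rule poly_mapping_eqI) (simp add: lookup_add g h)
    obtain m where "m \<in> Poly_Mapping.keys f" "W m = min_weight W f"
      using min_weight_attained[OF assms] .
    then have "Poly_Mapping.lookup g m \<noteq> 0" by (simp add: g in_keys_iff)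
    then show "g \<noteq> 0" by auto
  next
    fix m assume "m \<in> Poly_Mapping.keys g"
    then show "W m = min_weight W f" by (auto simp: g in_keys_iff split: if_splits)
  next
    fix m assume "m \<in> Poly_Mapping.keys h"
    then show "W m > min_weight W f"
      using min_weight_le[of m f W] by (auto simp: h in_keys_iff split: if_splits)
  qed
qed

lemma min_weight_mult:
  fixes f g :: "('n::{finite,linorder}, 'k::Fields.field) mpoly"
  assumes W: "\<And>a b. W (a + b) = W a + W b" and f: "f \<noteq> 0" and g: "g \<noteq> 0"
  shows "min_weight W (f * g) = min_weight W f + min_weight W g"
proof (rule antisym)
  obtain f0 f1 where f01: "f = f0 + f1" "f0 \<noteq> 0"
    "\<And>m. m \<in> Poly_Mapping.keys f0 \<Longrightarrow> W m = min_weight W f"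
    "\<And>m. m \<in> Poly_Mapping.keys f1 \<Longrightarrow> W m > min_weight W f"
    using split_min_weight[OF f] by blast
  obtain g0 g1 where g01: "g = g0 + g1" "g0 \<noteq> 0"
    "\<And>m. m \<in> Poly_Mapping.keys g0 \<Longrightarrow> W m = min_weight W g"
    "\<And>m. m \<in> Poly_Mapping.keys g1 \<Longrightarrow> W m > min_weight W g"
    using split_min_weight[OF g] by blast
  have "f0 * g0 \<noteq> 0" using f01(2) g01(2) by simp
  then obtain m where m: "m \<in> Poly_Mapping.keys (f0 * g0)" by fastforce
  have Wm: "W m = min_weight W f + min_weight W g"
    using keys_mult[of f0 g0] m W f01(3) g01(3) by fastforce
  have "W m' > min_weight W f + min_weight W g"
    if m': "m' \<in> Poly_Mapping.keys (f0 * g1 + f1 * g)" for m'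
  proof -
    consider "m' \<in> Poly_Mapping.keys (f0 * g1)" | "m' \<in> Poly_Mapping.keys (f1 * g)"
      using m' subsetD[OF keys_add[of "f0 * g1" "f1 * g"]] by blast
    then show ?thesis
    proof cases
      case 1
      then obtain a b where "m' = a + b" "a \<in> Poly_Mapping.keys f0" "b \<in> Poly_Mapping.keys g1"
        using keys_mult[of f0 g1] by blast
      then show ?thesis using W[of a b] f01(3)[of a] g01(4)[of b] by simp
    next
      case 2
      then obtain a b where "m' = a + b" "a \<in> Poly_Mapping.keys f1" "b \<in> Poly_Mapping.keys g"
        using keys_mult[of f1 g] by blast
      then show ?thesis using W[of a b] f01(4)[of a] min_weight_le[of b g W] by simp
    qed
  qed
  then have "m \<notin> Poly_Mapping.keys (f0 * g1 + f1 * g)" using Wm by force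
  moreover have "f * g = f0 * g0 + (f0 * g1 + f1 * g)"
    using f01(1) g01(1) by (simp add: algebra_simps)
  ultimately have "m \<in> Poly_Mapping.keys (f * g)"
    using m by (simp add: in_keys_iff lookup_add)
  then show "min_weight W (f * g) \<le> min_weight W f + min_weight W g"
    using min_weight_le[of m "f * g" W] Wm by simp
next
  show "min_weight W f + min_weight W g \<le> min_weight W (f * g)"
  proof (rule min_weight_geI)
    show "f * g \<noteq> 0" using f g by simp
    fix m assume "m \<in> Poly_Mapping.keys (f * g)"
    then obtain a b where "m = a + b" "a \<in> Poly_Mapping.keys f" "b \<in> Poly_Mapping.keys g"
      using keys_mult[of f g] by blast
    then show "min_weight W f + min_weight W g \<le> W m"
      using W[of a b] min_weight_le[of a f W] min_weight_le[of b g W] by simp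
  qed
qed

lemma keys_monom_of [simp]:
  "Poly_Mapping.keys (monom_of m :: ('n, 'k::Fields.field) mpoly) = {m}"
  by (simp add: monom_of_def)

lemma monom_of_nonzero [simp]: "(monom_of m :: ('n, 'k::Fields.field) mpoly) \<noteq> 0"
  using keys_monom_of[of m] by (metis insert_not_empty keys_zero)

lemma monomial_valuation_of_weight:
  fixes W :: "('n::{finite,linorder} \<Rightarrow>\<^sub>0 nat) \<Rightarrow> nat"
  assumes W: "\<And>a b. W (a + b) = W a + W b"
  shows "\<exists>v :: ('n, 'k::Fields.field) mpoly fract \<Rightarrow> real.
           monomial_valuation v \<and> (\<forall>m. v (to_fract (monom_of m)) = real (W m))"
proof -
  define w where "w = (\<lambda>f :: ('n, 'k) mpoly. real (min_weight W f))"
  define num where "num q = (SOME (f, g). g \<noteq> 0 \<and> q = Fract f g)" for q :: "('n, 'k) mpoly fract"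
  define v where "v q = w (fst (num q)) - w (snd (num q))" for q
  have v_Fract: "v (Fract f g) = w f - w g" if "f \<noteq> 0" "g \<noteq> 0" for f g
  proof -
    obtain f' g' where fg: "num (Fract f g) = (f', g')" by fastforce
    have "case num (Fract f g) of (f', g') \<Rightarrow> g' \<noteq> 0 \<and> Fract f g = Fract f' g'"
      unfolding num_def by (rule someI[of _ "(f, g)"]) (use that in auto)
    then have g': "g' \<noteq> 0" and "Fract f g = Fract f' g'" using fg by auto
    then have eq: "f * g' = f' * g" using that by (simp add: eq_fract)
    then have "f' \<noteq> 0" using that g' by auto
    have "w f + w g' = w f' + w g"
      using arg_cong[OF eq, of "min_weight W"] that g' \<open>f' \<noteq> 0\<close>
      unfolding w_def by (simp add: min_weight_mult[OF W] del: of_nat_add flip: of_nat_add)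
    then show ?thesis using fg by (simp add: v_def)
  qed
  have W0: "W 0 = 0" using W[of 0 0] by simp
  have w_monom: "w (monom_of m) = real (W m)" for m
    by (simp add: w_def min_weight_def)
  have "w 1 = 0" using w_monom[of 0] W0 by (simp add: monom_of_def)
  then have v_to_fract: "v (to_fract f) = w f" if "f \<noteq> 0" for f
    using v_Fract[OF that, of 1] by (simp add: to_fract_def)
  have Fract_nz: "\<exists>f g. x = Fract f g \<and> f \<noteq> 0 \<and> g \<noteq> 0" if "x \<noteq> 0" for x :: "('n, 'k) mpoly fract"
    using that by (cases x) (auto simp: Zero_fract_def eq_fract)
  have val: "valuation v"
    unfolding valuation_def
  proof (intro conjI allI impI)
    fix x y :: "('n, 'k) mpoly fract" assume "x \<noteq> 0" "y \<noteq> 0"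
    then obtain f g h k where *: "x = Fract f g" "f \<noteq> 0" "g \<noteq> 0" "y = Fract h k" "h \<noteq> 0" "k \<noteq> 0"
      using Fract_nz by meson
    then have "v (x * y) = w (f * h) - w (g * k)" by (simp add: v_Fract)
    then show "v (x * y) = v x + v y"
      using * by (simp add: v_Fract w_def min_weight_mult[OF W])
  next
    fix x y :: "('n, 'k) mpoly fract" assume "x \<noteq> 0" "y \<noteq> 0" and xy: "x + y \<noteq> 0"
    then obtain f g h k where *: "x = Fract f g" "f \<noteq> 0" "g \<noteq> 0" "y = Fract h k" "h \<noteq> 0" "k \<noteq> 0"
      using Fract_nz by meson
    then have sum: "x + y = Fract (f * k + h * g) (g * k)" by simp
    have nz: "f * k + h * g \<noteq> 0"
      using xy unfolding sum by (auto simp: Zero_fract_def eq_fract)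
    obtain m where m: "m \<in> Poly_Mapping.keys (f * k + h * g)" "W m = min_weight W (f * k + h * g)"
      using min_weight_attained[OF nz] .
    then have "m \<in> Poly_Mapping.keys (f * k) \<or> m \<in> Poly_Mapping.keys (h * g)"
      using subsetD[OF keys_add[of "f * k" "h * g"]] by blast
    then have "min (min_weight W (f * k)) (min_weight W (h * g)) \<le> min_weight W (f * k + h * g)"
      using m(2) min_weight_le[of m _ W] by (metis min_le_iff_disj)
    then have "min (min_weight W f + min_weight W k) (min_weight W h + min_weight W g)
                 \<le> min_weight W (f * k + h * g)"
      using * by (simp add: min_weight_mult[OF W])
    moreover have "v (x + y) = w (f * k + h * g) - w (g * k)"
      unfolding sum by (rule v_Fract) (use nz * in auto)
    ultimately show "min (v x) (v y) \<le> v (x + y)"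
      using * by (auto simp: v_Fract w_def min_weight_mult[OF W] min_def split: if_splits)
  qed
  have "v (to_fract f) = Min ((\<lambda>m. v (to_fract (monom_of m))) ` Poly_Mapping.keys f)" if nz: "f \<noteq> 0" for f
  proof -
    obtain m where m: "m \<in> Poly_Mapping.keys f" "W m = min_weight W f"
      using min_weight_attained[OF nz] .
    have "Min ((\<lambda>m. real (W m)) ` Poly_Mapping.keys f) = real (min_weight W f)"
      by (rule Min_eqI) (use m min_weight_le[of _ f W] in \<open>auto intro!: rev_image_eqI[of m]\<close>)
    then show ?thesis
      using nz by (simp add: v_to_fract w_monom) (simp add: w_def)
  qed
  then show ?thesis
    using val v_to_fract w_monom by (intro exI[of _ v]) (auto simp: monomial_valuation_def)
qed

theorem prime_valuation:
  fixes P :: "('n::{finite,linorder}, 'k::Fields.field) mpoly set"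
  shows "monomial_valuation (prime_valuation P)"
    and "prime_valuation P (to_fract (monom_of m)) = real (\<Sum>i | Var i \<in> P. Poly_Mapping.lookup m i)"
proof -
  have "\<exists>v :: ('n, 'k) mpoly fract \<Rightarrow> real. monomial_valuation v \<and>
        (\<forall>m. v (to_fract (monom_of m)) = real (\<Sum>i | Var i \<in> P. Poly_Mapping.lookup m i))"
    by (rule monomial_valuation_of_weight) (simp add: lookup_add sum.distrib)
  from someI_ex[OF this, folded prime_valuation_def]
  show "monomial_valuation (prime_valuation P)"
    "prime_valuation P (to_fract (monom_of m)) = real (\<Sum>i | Var i \<in> P. Poly_Mapping.lookup m i)"
    by auto
qed

theorem monomial_valuation_unique:
  fixes v w :: "('n::{finite,linorder}, 'k::Fields.field) mpoly fract \<Rightarrow> real"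
  assumes "monomial_valuation v" "monomial_valuation w"
    and eq: "\<And>m. v (to_fract (monom_of m)) = w (to_fract (monom_of m))"
    and "x \<noteq> 0"
  shows "v x = w x"
proof -
  obtain f g where x: "x = Fract f g" "g \<noteq> 0" by (cases x)
  with \<open>x \<noteq> 0\<close> have f: "f \<noteq> 0" by (auto simp: Zero_fract_def eq_fract)
  have *: "x * to_fract g = to_fract f"
    using x by (simp add: to_fract_def eq_fract)
  have mult: "u (to_fract f) = u x + u (to_fract g)" if "monomial_valuation u"
    for u :: "('n, 'k) mpoly fract \<Rightarrow> real"
  proof -
    have "u (x * to_fract g) = u x + u (to_fract g)"
      using that x(2) \<open>x \<noteq> 0\<close> unfolding monomial_valuation_def valuation_def
      by (metis to_fract_eq_0_iff')
    then show ?thesis by (simp only: *)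
  qed
  have "v (to_fract h) = w (to_fract h)" if "h \<noteq> 0" for h
  proof -
    have "v (to_fract h) = Min ((\<lambda>m. v (to_fract (monom_of m))) ` Poly_Mapping.keys h)"
      using assms(1) that unfolding monomial_valuation_def by blast
    moreover have "w (to_fract h) = Min ((\<lambda>m. w (to_fract (monom_of m))) ` Poly_Mapping.keys h)"
      using assms(2) that unfolding monomial_valuation_def by blast
    ultimately show ?thesis by (simp only: eq)
  qed
  then show ?thesis
    using mult[OF assms(1)] mult[OF assms(2)] f x(2) by (metis add_right_cancel)
qed


subsection \<open>The limit defining the asymptotic value exists and is an infimum\<close>

lemma subadditive_limit:
  fixes u :: "nat \<Rightarrow> real"
  assumes sub: "\<And>m n. u (m + n) \<le> u m + u n" and nonneg: "\<And>n. 0 \<le> u n"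
  shows "(\<lambda>n. u n / real n) \<longlonglongrightarrow> (INF n\<in>{1..}. u n / real n)"
proof -
  define L where "L = (INF n\<in>{1..}. u n / real n)"
  have bdd: "bdd_below ((\<lambda>n. u n / real n) ` {1..})"
    by (rule bdd_belowI[of _ 0]) (use nonneg in auto)
  have iter: "u (q * m + r) \<le> real q * u m + u r" for q m r
  proof (induction q)
    case (Suc q)
    have "u (Suc q * m + r) \<le> u m + u (q * m + r)"
      using sub[of m "q * m + r"] by (simp add: add.assoc)
    with Suc show ?case by (simp add: algebra_simps)
  qed simp
  show ?thesis
    unfolding L_def[symmetric]
  proof (rule LIMSEQ_I)
    fix e :: real assume e: "0 < e"
    have "\<exists>m\<in>{1..}. u m / real m < L + e / 2"
      using cInf_lessD[of "(\<lambda>n. u n / real n) ` {1..}" "L + e / 2"] e by (auto simp: L_def)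
    then obtain m where m: "m \<ge> 1" "u m / real m < L + e / 2" by auto
    define M where "M = (\<Sum>r<m. u r)"
    have M: "u r \<le> M" if "r < m" for r
      unfolding M_def using that nonneg by (intro member_le_sum) auto
    obtain N :: nat where N: "real N > 2 * M / e" using reals_Archimedean2 by blast
    show "\<exists>N. \<forall>n\<ge>N. norm (u n / real n - L) < e"
    proof (intro exI allI impI)
      fix n assume n: "n \<ge> max 1 N"
      then have n0: "real n > 0" and Nn: "real N \<le> real n" by auto
      have "L \<le> u n / real n"
        unfolding L_def using n by (intro cINF_lower[OF bdd]) auto
      moreover have "u n / real n < L + e"
      proof -
        have "u n \<le> real (n div m) * u m + u (n mod m)"
          using iter[of "n div m" m "n mod m"] by simp
        also have "\<dots> \<le> (real n / real m) * u m + M"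
          using M[of "n mod m"] m nonneg[of m]
          by (intro add_mono mult_right_mono of_nat_div_le_of_nat) auto
        finally have "u n / real n \<le> ((real n / real m) * u m + M) / real n"
          by (rule divide_right_mono) simp
        also have "\<dots> = u m / real m + M / real n"
          using n0 by (simp add: add_divide_distrib)
        finally have 1: "u n / real n \<le> u m / real m + M / real n" .
        have "2 * M / e < real n" using N Nn by linarith
        then have "M / real n < e / 2" using e n0 by (simp add: pos_divide_less_eq mult.commute)
        with 1 m(2) show ?thesis by linarith
      qed
      ultimately show "norm (u n / real n - L) < e" by simp
    qed
  qed
qed

theorem asymptotic_value_limit:
  fixes v :: "'a::idom fract \<Rightarrow> real" and \<aa> :: "nat \<Rightarrow> 'a set"
  assumes val: "valuation v" and nonneg: "\<And>f. f \<noteq> 0 \<Longrightarrow> 0 \<le> v (to_fract f)"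
    and graded: "\<And>r s f g. f \<in> \<aa> r \<Longrightarrow> g \<in> \<aa> s \<Longrightarrow> f * g \<in> \<aa> (r + s)"
    and nz: "\<And>r. \<exists>f\<in>\<aa> r. f \<noteq> 0"
  shows "(\<lambda>r. ideal_value v (\<aa> r) / real r) \<longlonglongrightarrow> asymptotic_value v \<aa>"
    and "asymptotic_value v \<aa> = (INF r\<in>{1..}. ideal_value v (\<aa> r) / real r)"
proof -
  define u where "u r = ideal_value v (\<aa> r)" for r
  have ne: "(\<lambda>f. v (to_fract f)) ` (\<aa> r - {0}) \<noteq> {}" for r
    using nz[of r] by auto
  have bdd: "bdd_below ((\<lambda>f. v (to_fract f)) ` (\<aa> r - {0}))" for r
    by (rule bdd_belowI[of _ 0]) (use nonneg in auto)
  have "0 \<le> u r" for r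
    unfolding u_def ideal_value_def by (rule cInf_greatest[OF ne]) (use nonneg in auto)
  moreover have "u (r + s) \<le> u r + u s" for r s
  proof -
    have *: "u (r + s) \<le> v (to_fract f) + v (to_fract g)"
      if "f \<in> \<aa> r - {0}" "g \<in> \<aa> s - {0}" for f g
    proof -
      have "f * g \<in> \<aa> (r + s) - {0}" using that graded by auto
      then have "u (r + s) \<le> v (to_fract (f * g))"
        unfolding u_def ideal_value_def by (intro cInf_lower[OF _ bdd] imageI)
      also have "\<dots> = v (to_fract f) + v (to_fract g)"
        using val that unfolding valuation_def by simp
      finally show ?thesis .
    qed
    have "u (r + s) - v (to_fract g) \<le> u r" if "g \<in> \<aa> s - {0}" for g
      unfolding u_def[of r] ideal_value_def
      by (rule cInf_greatest[OF ne]) (use * that in force)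
    then have "u (r + s) - u r \<le> v (to_fract g)" if "g \<in> \<aa> s - {0}" for g
      using that by force
    then have "u (r + s) - u r \<le> u s"
      unfolding u_def[of s] ideal_value_def by (intro cInf_greatest[OF ne]) auto
    then show ?thesis by simp
  qed
  ultimately have lim: "(\<lambda>r. u r / real r) \<longlonglongrightarrow> (INF r\<in>{1..}. u r / real r)"
    by (intro subadditive_limit)
  then show "asymptotic_value v \<aa> = (INF r\<in>{1..}. ideal_value v (\<aa> r) / real r)"
    unfolding asymptotic_value_def u_def by (rule limI)
  with lim show "(\<lambda>r. ideal_value v (\<aa> r) / real r) \<longlonglongrightarrow> asymptotic_value v \<aa>"
    by (simp add: u_def)
qed

end

theory Submission
  imports Defs "HOL-Library.Cardinality"
begin

text \<open>
  Write \<open>P\<^sub>S\<close> for the ideal generated by the variables in \<open>S\<close>. The primes \<open>P\<^sub>S\<close>, with \<open>S\<close> ranging over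
  the minimal vertex covers of the generating exponents, are both the minimal and the associated
  primes of \<open>\<aa>\<close>, and \<open>\<aa>\<^sup>r\<close> localized at \<open>P\<^sub>S\<close> contracts to the polynomials all of whose monomials have
  degree at least \<open>r\<close> in the variables of \<open>S\<close>. Hence \<open>\<aa>\<^sup>(\<^sup>r\<^sup>)\<close> has value exactly \<open>r\<close> under each of the
  valuations, and, with \<open>h\<close> the least size of a cover, \<open>\<nu>(q) = h (q - 1)\<close>: the monomial
  \<open>(x\<^sub>1 \<cdots> x\<^sub>n)\<^sup>q\<^sup>-\<^sup>1\<close> attains the bound. That \<open>P\<^sub>S\<close> has height \<open>|S|\<close> follows from the fact that \<open>n + 1\<close>
  polynomials in \<open>n\<close> variables are algebraically dependent, which excludes chains of primes of
  length \<open>n + 1\<close>.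
\<close>

section \<open>Ideals, their powers and localizations\<close>

text \<open>The bridge from the record-based ideals to type-class arithmetic. Closure under negation
  comes from multiplying by -1.\<close>

lemma ideal_ring_of_iff:
  fixes I :: "'a::comm_ring_1 set"
  shows "ideal I ring_of \<longleftrightarrow> 0 \<in> I \<and> (\<forall>a\<in>I. \<forall>b\<in>I. a + b \<in> I) \<and> (\<forall>a\<in>I. \<forall>r. r * a \<in> I)"
proof -
  interpret R: cring "ring_of :: 'a ring" by (rule cring_from_type_algebra)
  show ?thesis
  proof (intro iffI conjI ballI allI)
    assume "ideal I ring_of"
    then interpret I: ideal I "ring_of :: 'a ring" .
    show "0 \<in> I" using I.zero_closed by (simp add: ring_of_type_algebra_def)
    show "a + b \<in> I" if "a \<in> I" "b \<in> I" for a b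
      using I.a_closed[OF that] by (simp add: ring_of_type_algebra_def)
    show "r * a \<in> I" if "a \<in> I" for r a
      using I.I_l_closed[OF that, of r] by (simp add: ring_of_type_algebra_def)
  next
    assume I: "0 \<in> I \<and> (\<forall>a\<in>I. \<forall>b\<in>I. a + b \<in> I) \<and> (\<forall>a\<in>I. \<forall>r. r * a \<in> I)"
    have minus: "- a \<in> I" if "a \<in> I" for a
      using I that by (metis mult_minus1)
    show "ideal I ring_of"
    proof (rule idealI)
      show "subgroup I (add_monoid (ring_of :: 'a ring))"
      proof (rule R.add.subgroupI)
        fix a assume a: "a \<in> I"
        have "a_inv ring_of a = - a"
          by (rule R.minus_equality) (auto simp: ring_of_type_algebra_def)
        then show "a_inv ring_of a \<in> I" using minus[OF a] by simp
      qed (use I in \<open>auto simp: ring_of_type_algebra_def\<close>)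
    qed (use I in \<open>auto simp: ring_of_type_algebra_def mult.commute intro: R.ring_axioms[unfolded ring_of_type_algebra_def]\<close>)
  qed
qed

lemma primeideal_ring_of_iff:
  fixes P :: "'a::comm_ring_1 set"
  shows "primeideal P ring_of \<longleftrightarrow>
    ideal P ring_of \<and> 1 \<notin> P \<and> (\<forall>a b. a * b \<in> P \<longrightarrow> a \<in> P \<or> b \<in> P)"
proof -
  have "1 \<in> P \<longleftrightarrow> P = UNIV" if "ideal P ring_of"
    using that by (metis UNIV_I UNIV_eq_I ideal_ring_of_iff mult.right_neutral)
  then show ?thesis
    using cring_from_type_algebra[where ?'a = 'a]
    by (auto simp: primeideal_def primeideal_axioms_def ring_of_type_algebra_def)
qed

lemma genideal_subset:
  assumes "ideal I R" "A \<subseteq> I"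
  shows "genideal R A \<subseteq> I"
  using assms by (auto simp: genideal_def)

lemma genideal_ring_of_ideal:
  "ideal (genideal ring_of A) (ring_of :: 'a::comm_ring_1 ring)"
  by (rule ring.genideal_ideal[OF ring_from_type_algebra]) (simp add: ring_of_type_algebra_def)

lemma subset_genideal: "A \<subseteq> genideal R A"
  by (auto simp: genideal_def)

lemma ideal_power_0: "ideal_power I 0 = UNIV"
  by (simp add: ideal_power_def nat_pow_def ideals_set_def ring_of_type_algebra_def)

lemma ideal_power_Suc: "ideal_power I (Suc n) = ideal_prod ring_of (ideal_power I n) I"
  by (simp add: ideal_power_def nat_pow_def ideals_set_def)

lemma ideal_ideal_power:
  fixes I :: "'a::comm_ring_1 set"
  assumes "ideal I ring_of"
  shows "ideal (ideal_power I n) ring_of"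
proof (induction n)
  case 0
  then show ?case by (auto simp: ideal_power_0 ideal_ring_of_iff)
next
  case (Suc n)
  then show ?case
    unfolding ideal_power_Suc
    by (intro ring.ideal_prod_is_ideal assms ring_from_type_algebra)
qed

lemma mult_ideal_power_Suc:
  assumes "f \<in> ideal_power I n" "g \<in> I"
  shows "f * g \<in> ideal_power I (Suc n)"
  using ideal_prod.prod[OF assms, where R = ring_of]
  by (simp add: ideal_power_Suc ring_of_type_algebra_def)

lemma power_mult_ideal_power:
  fixes I :: "'a::comm_ring_1 set"
  assumes "f \<in> ideal_power I m" "g \<in> I"
  shows "f * g ^ n \<in> ideal_power I (m + n)"
proof (induction n)
  case (Suc n)
  then show ?case
    using mult_ideal_power_Suc[OF Suc assms(2)] by (simp add: mult_ac)
qed (use assms in simp)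

lemma prime_prod_mem:
  fixes P :: "'a::comm_ring_1 set"
  assumes P: "primeideal P ring_of" and "finite A" "(\<Prod>i\<in>A. f i) \<in> P"
  shows "\<exists>i\<in>A. f i \<in> P"
  using assms(2,3)
  by (induction A rule: finite_induct) (use P in \<open>auto simp: primeideal_ring_of_iff\<close>)

lemma prime_power_mem:
  fixes P :: "'a::comm_ring_1 set"
  assumes P: "primeideal P ring_of" and "f ^ n \<in> P"
  shows "f \<in> P"
  using assms(2)
  by (induction n) (use P in \<open>auto simp: primeideal_ring_of_iff\<close>)

text \<open>A sum of fractions with numerators in \<open>J\<close> can be put over a common
  denominator, which stays outside the prime \<open>Q\<close>. So the extension of \<open>J\<close>
  to the localization consists of single fractions, and \<open>to_fract f\<close> is one of them
  exactly when some denominator multiplies \<open>f\<close> into \<open>J\<close>.\<close>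

lemma mem_localize_contract_iff:
  fixes Q :: "'a::idom set"
  assumes Q: "primeideal Q ring_of" and J: "ideal J ring_of"
  shows "f \<in> localize_contract Q J \<longleftrightarrow> (\<exists>g. g \<notin> Q \<and> g * f \<in> J)"
proof
  have Q0: "0 \<in> Q" and Q1: "1 \<notin> Q" and Qm: "\<And>a b. a \<notin> Q \<Longrightarrow> b \<notin> Q \<Longrightarrow> a * b \<notin> Q"
    using Q by (auto simp: primeideal_ring_of_iff ideal_ring_of_iff)
  have J0: "0 \<in> J" and Ja: "\<And>a b. a \<in> J \<Longrightarrow> b \<in> J \<Longrightarrow> a + b \<in> J"
    and Jm: "\<And>a r. a \<in> J \<Longrightarrow> r * a \<in> J"
    using J by (auto simp: ideal_ring_of_iff)
  have nz: "g \<noteq> 0" if "g \<notin> Q" for g using that Q0 by auto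
  let ?L = "{Fract f g | f g. g \<notin> Q}"
  {
    assume "f \<in> localize_contract Q J"
    then have f: "to_fract f \<in> genideal (localization Q) (to_fract ` J)"
      by (simp add: localize_contract_def)
    interpret F: cring "ring_of :: 'a fract ring" by (rule cring_from_type_algebra)
    have minus: "a_inv ring_of x = - x" for x :: "'a fract"
      by (rule F.minus_equality) (auto simp: ring_of_type_algebra_def)
    \<comment> \<open>The ring axioms of the localization are inherited from the fraction
      field.\<close>
    have "subring ?L (ring_of :: 'a fract ring)"
    proof (rule F.subringI)
      show "\<one>\<^bsub>ring_of\<^esub> \<in> ?L"
        using Q1 by (auto simp: ring_of_type_algebra_def One_fract_def)
      fix h assume "h \<in> ?L"
      then show "\<ominus>\<^bsub>ring_of\<^esub> h \<in> ?L"
        unfolding minus by (auto simp: minus_fract) (metis minus_fract)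
      fix k assume "k \<in> ?L"
      with \<open>h \<in> ?L\<close> obtain a b c d where
        "h = Fract a b" "b \<notin> Q" "k = Fract c d" "d \<notin> Q" by auto
      then show "h \<otimes>\<^bsub>ring_of\<^esub> k \<in> ?L" "h \<oplus>\<^bsub>ring_of\<^esub> k \<in> ?L"
        using Qm[of b d] nz by (auto simp: ring_of_type_algebra_def intro!: exI)
    qed (auto simp: ring_of_type_algebra_def)
    then have ringL: "ring (localization Q)"
      unfolding localization_def by (rule F.subring_is_ring)
    interpret L: ring "localization Q" by (rule ringL)
    have minusL: "a_inv (localization Q) (Fract a b) = Fract (- a) b" if "b \<notin> Q" for a b
    proof (rule L.minus_equality)
      show "Fract (- a) b \<oplus>\<^bsub>localization Q\<^esub> Fract a b = \<zero>\<^bsub>localization Q\<^esub>"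
        using nz[OF that] by (simp add: localization_def ring_of_type_algebra_def Zero_fract_def eq_fract)
    qed (use that in \<open>auto simp: localization_def\<close>)
    \<comment> \<open>An explicit form of the extended ideal. Being an ideal that contains the image
      of \<open>J\<close>, it contains the generated one.\<close>
    let ?I = "{Fract h g | h g. h \<in> J \<and> g \<notin> Q}"
    have "ideal ?I (localization Q)"
    proof (rule idealI[OF ringL])
      show "subgroup ?I (add_monoid (localization Q))"
      proof (rule L.add.subgroupI)
        show "?I \<subseteq> carrier (localization Q)" by (auto simp: localization_def)
        show "?I \<noteq> {}" using J0 Q1 by auto
        fix x assume x: "x \<in> ?I"
        then show "\<ominus>\<^bsub>localization Q\<^esub> x \<in> ?I"
          using Jm[of _ "-1"] by (auto simp: minusL) blast
        fix y assume "y \<in> ?I"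
        with x obtain a b c d where
          "x = Fract a b" "b \<notin> Q" "a \<in> J" "y = Fract c d" "d \<notin> Q" "c \<in> J" by auto
        moreover from this have "d * a + b * c \<in> J" by (intro Ja Jm)
        ultimately show "x \<oplus>\<^bsub>localization Q\<^esub> y \<in> ?I"
          using Qm[of b d] nz
          by (auto simp: localization_def ring_of_type_algebra_def mult.commute intro!: exI)
      qed
    next
      fix a x assume "a \<in> ?I" "x \<in> carrier (localization Q)"
      then obtain h g u v where *: "a = Fract h g" "h \<in> J" "g \<notin> Q" "x = Fract u v" "v \<notin> Q"
        by (auto simp: localization_def)
      have eq: "x \<otimes>\<^bsub>localization Q\<^esub> a = Fract (u * h) (v * g)"
        "a \<otimes>\<^bsub>localization Q\<^esub> x = Fract (u * h) (v * g)"
        using * by (simp_all add: localization_def ring_of_type_algebra_def mult.commute)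
      then show "x \<otimes>\<^bsub>localization Q\<^esub> a \<in> ?I" "a \<otimes>\<^bsub>localization Q\<^esub> x \<in> ?I"
        unfolding eq using Jm[OF *(2), of u] Qm[OF *(5,3)] by blast+
    qed
    moreover have "to_fract ` J \<subseteq> ?I" using Q1 by (auto simp: to_fract_def)
    ultimately have "to_fract f \<in> ?I" using f genideal_subset by blast
    then obtain h g where hg: "to_fract f = Fract h g" "h \<in> J" "g \<notin> Q" by auto
    then have "g * f = h" using nz[OF hg(3)] by (simp add: to_fract_def eq_fract mult.commute)
    then show "\<exists>g. g \<notin> Q \<and> g * f \<in> J" using hg by auto
  }
  {
    assume "\<exists>g. g \<notin> Q \<and> g * f \<in> J"
    then obtain g where g: "g \<notin> Q" "g * f \<in> J" by auto
    show "f \<in> localize_contract Q J"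
      unfolding localize_contract_def genideal_def
    proof (intro CollectI InterI)
      fix I assume "I \<in> {I. ideal I (localization Q) \<and> to_fract ` J \<subseteq> I}"
      then have I: "ideal I (localization Q)" and "to_fract (g * f) \<in> I" using g(2) by auto
      \<comment> \<open>Since \<open>g\<close> is outside \<open>Q\<close>, its inverse belongs to
        the localization.\<close>
      then have "Fract 1 g \<otimes>\<^bsub>localization Q\<^esub> to_fract (g * f) \<in> I"
        using g(1) by (intro ideal.I_l_closed[OF I]) (auto simp: localization_def)
      also have "Fract 1 g \<otimes>\<^bsub>localization Q\<^esub> to_fract (g * f) = to_fract f"
        using nz[OF g(1)] by (simp add: localization_def ring_of_type_algebra_def to_fract_def eq_fract)
      finally show "to_fract f \<in> I" .
    qed
  }
qed

section \<open>Monomial ideals and weights\<close>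

lemma poly_mapping_sum_single:
  "f = (\<Sum>k\<in>Poly_Mapping.keys f. Poly_Mapping.single k (Poly_Mapping.lookup f k))"
proof (rule poly_mapping_eqI)
  fix k
  have "Poly_Mapping.lookup (\<Sum>k\<in>Poly_Mapping.keys f. Poly_Mapping.single k (Poly_Mapping.lookup f k)) k
      = (\<Sum>j\<in>Poly_Mapping.keys f. if j = k then Poly_Mapping.lookup f k else 0)"
    unfolding lookup_sum by (rule sum.cong) (auto simp: lookup_single when_def)
  then show "Poly_Mapping.lookup f k = Poly_Mapping.lookup
      (\<Sum>k\<in>Poly_Mapping.keys f. Poly_Mapping.single k (Poly_Mapping.lookup f k)) k"
    by (simp add: in_keys_iff)
qed

lemma monom_of_add: "monom_of (k + l) = monom_of k * monom_of l"
  by (simp add: monom_of_def mult_single)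

lemma monom_of_0: "monom_of 0 = 1"
  by (simp add: monom_of_def)

lemma monom_of_sum: "finite A \<Longrightarrow> monom_of (\<Sum>i\<in>A. k i) = (\<Prod>i\<in>A. monom_of (k i))"
  by (induction A rule: finite_induct) (simp_all add: monom_of_add monom_of_0)

lemma sum_single_lookup:
  "(\<Sum>i\<in>UNIV. Poly_Mapping.single i (Poly_Mapping.lookup k i)) = (k :: 'n::finite \<Rightarrow>\<^sub>0 nat)"
proof (rule poly_mapping_eqI)
  fix j
  have "Poly_Mapping.lookup (\<Sum>i\<in>UNIV. Poly_Mapping.single i (Poly_Mapping.lookup k i)) j
      = (\<Sum>i\<in>UNIV. if i = j then Poly_Mapping.lookup k j else 0)"
    unfolding lookup_sum by (rule sum.cong) (auto simp: lookup_single when_def)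
  then show "Poly_Mapping.lookup (\<Sum>i\<in>UNIV. Poly_Mapping.single i (Poly_Mapping.lookup k i)) j
      = Poly_Mapping.lookup k j" by simp
qed

lemma Var_power: "Var i ^ q = monom_of (Poly_Mapping.single i q)"
proof (induction q)
  case (Suc q)
  then show ?case
    by (simp add: Var_def flip: monom_of_add single_add)
qed (simp add: monom_of_0)

lemma monom_of_eq_prod_Var:
  "monom_of (k :: 'n::finite \<Rightarrow>\<^sub>0 nat) = (\<Prod>i\<in>UNIV. Var i ^ Poly_Mapping.lookup k i)"
  unfolding Var_power by (simp add: sum_single_lookup flip: monom_of_sum)

text \<open>Multiplication by a monomial shifts exponents injectively, so no two terms can
  cancel.\<close>

lemma keys_mult_monom_of:
  fixes f :: "('n::{finite,linorder}, 'k::Fields.field) mpoly"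
  shows "Poly_Mapping.keys (f * monom_of l) = (\<lambda>k. k + l) ` Poly_Mapping.keys f"
proof -
  have "f * monom_of l = (\<Sum>k\<in>Poly_Mapping.keys f. Poly_Mapping.single (k + l) (Poly_Mapping.lookup f k))"
    by (subst (1) poly_mapping_sum_single[of f])
       (simp add: sum_distrib_right monom_of_def mult_single)
  then have "Poly_Mapping.lookup (f * monom_of l) (k + l) = Poly_Mapping.lookup f k" for k
    by (auto simp: lookup_sum lookup_single when_def in_keys_iff)
  moreover have "Poly_Mapping.keys (f * monom_of l) \<subseteq> (\<lambda>k. k + l) ` Poly_Mapping.keys f"
    using keys_mult[of f "monom_of l"] by auto
  ultimately show ?thesis by (auto simp: in_keys_iff)
qed

text \<open>Membership in a monomial ideal is decided term by term: the right-hand side is an ideal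
  containing the generators, and conversely each such term is a multiple of a generator and the
  terms add up to \<open>f\<close>.\<close>

lemma Idl_monom_of:
  fixes M :: "('n::{finite,linorder} \<Rightarrow>\<^sub>0 nat) set"
  shows "Idl\<^bsub>ring_of\<^esub> (monom_of ` M) =
    {f :: ('n, 'k::Fields.field) mpoly. \<forall>k\<in>Poly_Mapping.keys f. \<exists>m\<in>M. \<exists>l. k = m + l}" (is "_ = ?I")
proof
  have "ideal ?I ring_of"
    unfolding ideal_ring_of_iff
  proof (intro conjI ballI allI)
    fix f g :: "('n, 'k) mpoly" assume "f \<in> ?I" "g \<in> ?I"
    then show "f + g \<in> ?I"
      using keys_add[of f g] by blast
  next
    fix f r :: "('n, 'k) mpoly" assume f: "f \<in> ?I"
    have "\<exists>m\<in>M. \<exists>l. k = m + l" if "k \<in> Poly_Mapping.keys (r * f)" for k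
    proof -
      have "k \<in> {a + b |a b. a \<in> Poly_Mapping.keys r \<and> b \<in> Poly_Mapping.keys f}"
        using that keys_mult by (rule rev_subsetD)
      then obtain a b where "k = a + b" "b \<in> Poly_Mapping.keys f" by blast
      moreover then obtain m l where "m \<in> M" "b = m + l" using f by blast
      ultimately show ?thesis by (metis add.left_commute)
    qed
    then show "r * f \<in> ?I" by simp
  qed simp
  moreover have "monom_of ` M \<subseteq> ?I" by auto (metis add.right_neutral)
  ultimately show "Idl\<^bsub>ring_of\<^esub> (monom_of ` M) \<subseteq> ?I" by (rule genideal_subset)
next
  show "?I \<subseteq> Idl\<^bsub>ring_of\<^esub> (monom_of ` M)"
  proof
    fix f :: "('n, 'k) mpoly" assume f: "f \<in> ?I"
    have I: "ideal (Idl\<^bsub>ring_of\<^esub> (monom_of ` M)) (ring_of :: ('n, 'k) mpoly ring)"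
      by (rule genideal_ring_of_ideal)
    \<comment> \<open>Partial sums over subsets of the keys make the induction on finite sets
      available.\<close>
    have "(\<Sum>k\<in>K. Poly_Mapping.single k (Poly_Mapping.lookup f k)) \<in> Idl\<^bsub>ring_of\<^esub> (monom_of ` M)"
      if "finite K" "K \<subseteq> Poly_Mapping.keys f" for K
      using that
    proof (induction K rule: finite_induct)
      case empty
      then show ?case using I by (simp add: ideal_ring_of_iff)
    next
      case (insert k K)
      then obtain m l where m: "m \<in> M" "k = m + l" using f by blast
      have "(monom_of m :: ('n, 'k) mpoly) \<in> Idl\<^bsub>ring_of\<^esub> (monom_of ` M)"
        by (rule subsetD[OF subset_genideal]) (use m(1) in simp)
      then have "Poly_Mapping.single l (Poly_Mapping.lookup f k) * monom_of m \<in> Idl\<^bsub>ring_of\<^esub> (monom_of ` M)"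
        using I by (simp add: ideal_ring_of_iff)
      then have "Poly_Mapping.single k (Poly_Mapping.lookup f k) \<in> Idl\<^bsub>ring_of\<^esub> (monom_of ` M)"
        by (simp add: monom_of_def mult_single m(2) add.commute)
      then show ?case using insert I by (simp add: ideal_ring_of_iff)
    qed
    from this[of "Poly_Mapping.keys f"] show "f \<in> Idl\<^bsub>ring_of\<^esub> (monom_of ` M)"
      by (subst poly_mapping_sum_single) simp
  qed
qed

lemma monom_of_mem_Idl:
  "(monom_of k :: ('n::{finite,linorder}, 'k::Fields.field) mpoly) \<in> Idl\<^bsub>ring_of\<^esub> (monom_of ` M)
    \<longleftrightarrow> (\<exists>m\<in>M. \<exists>l. k = m + l)"
  by (simp add: Idl_monom_of)

lemma exponent_le_iff:
  fixes k m :: "'n::finite \<Rightarrow>\<^sub>0 nat"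
  shows "(\<exists>l. k = m + l) \<longleftrightarrow> (\<forall>i. Poly_Mapping.lookup m i \<le> Poly_Mapping.lookup k i)"
proof
  assume le: "\<forall>i. Poly_Mapping.lookup m i \<le> Poly_Mapping.lookup k i"
  \<comment> \<open>Subtraction of exponents is truncated at 0; \<open>le\<close> makes it
    exact.\<close>
  have "k = m + (k - m)"
    by (rule poly_mapping_eqI) (use le in \<open>simp add: lookup_add lookup_minus\<close>)
  then show "\<exists>l. k = m + l" by blast
qed (auto simp: lookup_add)

lemma mem_frobenius_power_max:
  fixes f :: "('n::{finite,linorder}, 'k::Fields.field) mpoly"
  shows "f \<in> frobenius_power_max q \<longleftrightarrow>
    (\<forall>k\<in>Poly_Mapping.keys f. \<exists>i. q \<le> Poly_Mapping.lookup k i)"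
proof -
  have "range (\<lambda>i. Var i ^ q :: ('n, 'k) mpoly) = monom_of ` range (\<lambda>i. Poly_Mapping.single i q)"
    by (auto simp: Var_power)
  moreover have "(\<forall>j. Poly_Mapping.lookup (Poly_Mapping.single i q) j \<le> Poly_Mapping.lookup k j) \<longleftrightarrow>
      q \<le> Poly_Mapping.lookup k i" for i and k :: "'n \<Rightarrow>\<^sub>0 nat"
    by (auto simp: lookup_single when_def)
  ultimately show ?thesis
    by (simp add: frobenius_power_max_def Idl_monom_of exponent_le_iff)
qed

section \<open>Weights and the ideals they define\<close>

definition weight :: "'n set \<Rightarrow> ('n \<Rightarrow>\<^sub>0 nat) \<Rightarrow> nat" where
  "weight S k = (\<Sum>i\<in>S. Poly_Mapping.lookup k i)"

lemma weight_add: "weight S (k + l) = weight S k + weight S l"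
  by (simp add: weight_def lookup_add sum.distrib)

lemma one_le_weight_iff: "1 \<le> weight S k \<longleftrightarrow> (\<exists>i\<in>S. Poly_Mapping.lookup k i \<noteq> 0)"
  for S :: "'n::finite set"
proof -
  have "1 \<le> weight S k \<longleftrightarrow> weight S k \<noteq> 0" by linarith
  then show ?thesis by (simp add: weight_def)
qed

text \<open>With P_S the ideal generated by the variables in \<open>S\<close>, this is the
  \<open>r\<close>-th power of P_S, described by its monomials; \<open>r = 1\<close> gives P_S
  itself.\<close>

definition weight_ideal :: "'n set \<Rightarrow> nat \<Rightarrow> ('n, 'k::comm_ring_1) mpoly set" where
  "weight_ideal S r = {f. \<forall>k\<in>Poly_Mapping.keys f. r \<le> weight S k}"

text \<open>The link to the order function \<open>min_weight\<close>, whose additivity on products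
  drives what follows. The zero polynomial stands apart because there \<open>min_weight\<close> is a
  \<open>Min\<close> over the empty set.\<close>

lemma mem_weight_ideal_iff:
  "f \<in> weight_ideal S r \<longleftrightarrow> f = 0 \<or> r \<le> min_weight (weight S) f"
proof (cases "f = 0")
  case False
  then show ?thesis
    using min_weight_le[of _ f "weight S"] min_weight_geI[of f r "weight S"]
    by (auto simp: weight_ideal_def intro: order_trans)
qed (simp add: weight_ideal_def)

lemma mult_weight_ideal:
  fixes f g :: "('n::{finite,linorder}, 'k::Fields.field) mpoly"
  assumes "f \<in> weight_ideal S r" "g \<in> weight_ideal S s"
  shows "f * g \<in> weight_ideal S (r + s)"
proof (cases "f = 0 \<or> g = 0")
  case False
  then show ?thesis
    using assms by (auto simp: mem_weight_ideal_iff min_weight_mult[OF weight_add])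
qed (auto simp: mem_weight_ideal_iff)

lemma ideal_weight_ideal:
  "ideal (weight_ideal S r :: ('n::{finite,linorder}, 'k::Fields.field) mpoly set) ring_of"
  unfolding ideal_ring_of_iff
proof (intro conjI ballI allI)
  fix f g :: "('n, 'k) mpoly" assume "f \<in> weight_ideal S r" "g \<in> weight_ideal S r"
  then show "f + g \<in> weight_ideal S r"
    using keys_add[of f g] by (auto simp: weight_ideal_def)
next
  fix f g :: "('n, 'k) mpoly" assume "f \<in> weight_ideal S r"
  then show "g * f \<in> weight_ideal S r"
    using mult_weight_ideal[of g S 0 f r] by (simp add: weight_ideal_def)
qed (simp add: weight_ideal_def)

text \<open>A factor outside P_S has \<open>min_weight\<close> 0, so by additivity it does not
  change the order of a nonzero product. For \<open>r = 1\<close> this is primality of P_S; for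
  general \<open>r\<close> it shows that localizing at P_S adds nothing to this ideal.\<close>

lemma weight_ideal_cancel:
  fixes f g :: "('n::{finite,linorder}, 'k::Fields.field) mpoly"
  assumes "g \<notin> weight_ideal S 1" "g * f \<in> weight_ideal S r"
  shows "f \<in> weight_ideal S r"
proof (cases "f = 0")
  case False
  then show ?thesis
    using assms min_weight_mult[OF weight_add[of S], of g f] by (auto simp: mem_weight_ideal_iff)
qed (simp add: mem_weight_ideal_iff)

lemma primeideal_weight_ideal:
  "primeideal (weight_ideal S 1 :: ('n::{finite,linorder}, 'k::Fields.field) mpoly set) ring_of"
proof -
  have "(1 :: ('n, 'k) mpoly) \<notin> weight_ideal S 1"
    by (simp add: weight_ideal_def weight_def flip: monom_of_0)
  then show ?thesis
    using ideal_weight_ideal weight_ideal_cancel by (fastforce simp: primeideal_ring_of_iff)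
qed

lemma Var_mem_weight_ideal [simp]:
  "(Var i :: ('n::{finite,linorder}, 'k::Fields.field) mpoly) \<in> weight_ideal S 1 \<longleftrightarrow> i \<in> S"
  by (simp add: weight_ideal_def Var_def weight_def lookup_single when_def Suc_le_eq)

text \<open>A monomial of positive weight is divisible by a variable from \<open>S\<close>, so these
  variables generate \<open>weight_ideal S 1\<close>.\<close>

lemma weight_ideal_subset_prime:
  fixes Q :: "('n::{finite,linorder}, 'k::Fields.field) mpoly set"
  assumes Q: "ideal Q ring_of" and "\<And>i. i \<in> S \<Longrightarrow> Var i \<in> Q"
  shows "weight_ideal S 1 \<subseteq> Q"
proof -
  have "(weight_ideal S 1 :: ('n, 'k) mpoly set) \<subseteq> Idl\<^bsub>ring_of\<^esub> (monom_of ` (\<lambda>i. Poly_Mapping.single i 1) ` S)"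
    unfolding Idl_monom_of
  proof (intro subsetI CollectI ballI)
    fix f :: "('n, 'k) mpoly" and k assume "f \<in> weight_ideal S 1" "k \<in> Poly_Mapping.keys f"
    then have "weight S k \<noteq> 0" by (auto simp: weight_ideal_def)
    then obtain i where "i \<in> S" "Poly_Mapping.lookup k i \<noteq> 0"
      by (auto simp: weight_def)
    then show "\<exists>m\<in>(\<lambda>i. Poly_Mapping.single i 1) ` S. \<exists>l. k = m + l"
      by (intro bexI[of _ "Poly_Mapping.single i 1"])
         (auto simp: exponent_le_iff lookup_single when_def Suc_le_eq)
  qed
  also have "\<dots> \<subseteq> Q"
    by (rule genideal_subset[OF Q]) (use assms in \<open>auto simp: Var_def\<close>)
  finally show ?thesis .
qed

lemma weight_ideal_mono: "S \<subseteq> T \<Longrightarrow>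
    (weight_ideal S 1 :: ('n::{finite,linorder}, 'k::Fields.field) mpoly set) \<subseteq> weight_ideal T 1"
  by (rule weight_ideal_subset_prime[OF ideal_weight_ideal]) (auto simp del: One_nat_def)

lemma weight_ideal_subset_iff:
  "(weight_ideal S 1 :: ('n::{finite,linorder}, 'k::Fields.field) mpoly set) \<subseteq> weight_ideal T 1 \<longleftrightarrow> S \<subseteq> T"
  using weight_ideal_mono Var_mem_weight_ideal by blast

text \<open>Weights add under multiplication, and the bound survives the sums from which
  \<open>ideal_prod\<close> is built.\<close>

lemma ideal_power_weight_ideal:
  fixes I :: "('n::{finite,linorder}, 'k::Fields.field) mpoly set"
  assumes "I \<subseteq> weight_ideal S 1"
  shows "ideal_power I r \<subseteq> weight_ideal S r"
proof (induction r)
  case (Suc r)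
  show ?case
  proof
    fix f assume "f \<in> ideal_power I (Suc r)"
    then show "f \<in> weight_ideal S (Suc r)"
      unfolding ideal_power_Suc
    proof (induction rule: ideal_prod.induct)
      case (prod f g)
      then show ?case
        using Suc assms mult_weight_ideal[of f S r g 1] by (auto simp: ring_of_type_algebra_def)
    next
      case (sum f g)
      then show ?case
        using ideal_weight_ideal[of S "Suc r", where ?'k = 'k]
        by (simp add: ideal_ring_of_iff) (simp add: ring_of_type_algebra_def)
    qed
  qed
qed (simp add: weight_ideal_def)

section \<open>Heights of primes generated by variables\<close>

text \<open>Gaussian elimination, by induction on the set of equations: an equation \<open>b\<close>
  with a nonzero coefficient at \<open>p\<close> is solved for that unknown, leaving one equation
  and one unknown fewer.\<close>

lemma exists_nontrivial_solution:
  fixes u :: "'i \<Rightarrow> 'b \<Rightarrow> 'k::Fields.field"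
  assumes "finite B" "finite I" "card B < card I"
  shows "\<exists>c. (\<exists>i\<in>I. c i \<noteq> 0) \<and> (\<forall>b\<in>B. (\<Sum>i\<in>I. c i * u i b) = 0)"
  using assms
proof (induction B arbitrary: I u rule: finite_induct)
  case empty
  then have "I \<noteq> {}" by auto
  then show ?case by (intro exI[of _ "\<lambda>_. 1"]) auto
next
  case (insert b B)
  show ?case
  proof (cases "\<forall>i\<in>I. u i b = 0")
    case True
    obtain c where "\<exists>i\<in>I. c i \<noteq> 0" "\<forall>b\<in>B. (\<Sum>i\<in>I. c i * u i b) = 0"
      using insert.IH[of I u] insert.prems insert.hyps by auto
    with True show ?thesis by (intro exI[of _ c]) auto
  next
    case False
    then obtain p where p: "p \<in> I" "u p b \<noteq> 0" by auto
    \<comment> \<open>The coefficients after the unknown \<open>p\<close> has been eliminated by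
      means of equation \<open>b\<close>.\<close>
    define u' where "u' i b' = u i b' - u i b / u p b * u p b'" for i b'
    have "card B < card (I - {p})"
      using insert.prems insert.hyps p by (simp add: card_Diff_singleton)
    then obtain c where c: "\<exists>i\<in>I - {p}. c i \<noteq> 0"
      "\<And>b'. b' \<in> B \<Longrightarrow> (\<Sum>i\<in>I - {p}. c i * u' i b') = 0"
      using insert.IH[of "I - {p}" u'] insert.prems by auto
    \<comment> \<open>The value that equation \<open>b\<close> forces on the unknown
      \<open>p\<close>.\<close>
    define a where "a = - (\<Sum>i\<in>I - {p}. c i * u i b) / u p b"
    define d where "d = c(p := a)"
    have split: "(\<Sum>i\<in>I. d i * u i b') = (\<Sum>i\<in>I - {p}. c i * u i b') + a * u p b'" for b'
    proof -
      have "(\<Sum>i\<in>I. d i * u i b') = d p * u p b' + (\<Sum>i\<in>I - {p}. d i * u i b')"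
        using p insert.prems by (intro sum.remove) auto
      then show ?thesis by (simp add: d_def)
    qed
    have "(\<Sum>i\<in>I. d i * u i b) = 0"
      unfolding split using p by (simp add: a_def)
    moreover have "(\<Sum>i\<in>I. d i * u i b') = 0" if "b' \<in> B" for b'
    proof -
      have "(\<Sum>i\<in>I. d i * u i b') = (\<Sum>i\<in>I - {p}. c i * u' i b')"
        unfolding split u'_def a_def
        by (simp add: sum_subtractf right_diff_distrib sum_distrib_right sum_divide_distrib mult.assoc)
      then show ?thesis using c(2)[OF that] by simp
    qed
    moreover have "\<exists>i\<in>I. d i \<noteq> 0" using c(1) by (auto simp: d_def)
    ultimately show ?thesis by blast
  qed
qed

section \<open>Algebraic dependence by counting exponents\<close>

definition exponent_box :: "nat \<Rightarrow> ('n \<Rightarrow>\<^sub>0 nat) set" where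
  "exponent_box D = {k. \<forall>i. Poly_Mapping.lookup k i \<le> D}"

lemma finite_exponent_box: "finite (exponent_box D :: ('n::finite \<Rightarrow>\<^sub>0 nat) set)"
  and card_exponent_box_le: "card (exponent_box D :: ('n::finite \<Rightarrow>\<^sub>0 nat) set) \<le> Suc D ^ CARD('n)"
proof -
  let ?B = "exponent_box D :: ('n \<Rightarrow>\<^sub>0 nat) set"
  have inj: "inj_on Poly_Mapping.lookup ?B" by (rule inj_onI) (rule lookup_inject[THEN iffD1])
  have sub: "Poly_Mapping.lookup ` ?B \<subseteq> Pi\<^sub>E UNIV (\<lambda>_. {..D})"
    by (auto simp: exponent_box_def)
  have fin: "finite (Pi\<^sub>E (UNIV :: 'n set) (\<lambda>_. {..D}))" by (rule finite_PiE) auto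
  show "finite ?B" using finite_imageD[OF finite_subset[OF sub fin] inj] .
  have "card ?B \<le> card (Pi\<^sub>E (UNIV :: 'n set) (\<lambda>_. {..D}))"
    using card_inj_on_le[OF inj sub fin] .
  then show "card ?B \<le> Suc D ^ CARD('n)" by (simp add: card_PiE)
qed

lemma keys_mult_exponent_box:
  assumes "Poly_Mapping.keys f \<subseteq> exponent_box D" "Poly_Mapping.keys g \<subseteq> exponent_box E"
  shows "Poly_Mapping.keys (f * g) \<subseteq> exponent_box (D + E)"
proof
  fix k assume "k \<in> Poly_Mapping.keys (f * g)"
  then have "k \<in> {a + b |a b. a \<in> Poly_Mapping.keys f \<and> b \<in> Poly_Mapping.keys g}"
    using keys_mult by (rule rev_subsetD)
  then show "k \<in> exponent_box (D + E)"
    using assms by (fastforce simp: exponent_box_def lookup_add intro: add_mono)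
qed

lemma keys_power_exponent_box:
  fixes f :: "('n, 'k::Fields.field) mpoly"
  assumes "Poly_Mapping.keys f \<subseteq> exponent_box D"
  shows "Poly_Mapping.keys (f ^ e) \<subseteq> exponent_box (e * D)"
proof (induction e)
  case (Suc e)
  then show ?case
    using keys_mult_exponent_box[OF assms Suc] by simp
qed (simp add: exponent_box_def)

lemma keys_prod_exponent_box:
  fixes f :: "'i \<Rightarrow> ('n, 'k::Fields.field) mpoly"
  assumes "finite A" "\<And>i. i \<in> A \<Longrightarrow> Poly_Mapping.keys (f i) \<subseteq> exponent_box D"
  shows "Poly_Mapping.keys (\<Prod>i\<in>A. f i) \<subseteq> exponent_box (card A * D)"
  using assms
proof (induction A rule: finite_induct)
  case (insert i A)
  then have "Poly_Mapping.keys (f i * (\<Prod>i\<in>A. f i)) \<subseteq> exponent_box (D + card A * D)"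
    by (intro keys_mult_exponent_box) auto
  with insert show ?case by simp
qed (simp add: exponent_box_def)

lemma exponent_box_mono: "D \<le> E \<Longrightarrow> exponent_box D \<subseteq> exponent_box E"
  by (auto simp: exponent_box_def intro: order_trans)

lemma exponent_box_bound:
  fixes f :: "'i \<Rightarrow> ('n::finite \<Rightarrow>\<^sub>0 nat) \<Rightarrow>\<^sub>0 'k::zero"
  assumes "finite A"
  obtains D where "\<And>i. i \<in> A \<Longrightarrow> Poly_Mapping.keys (f i) \<subseteq> exponent_box D"
proof -
  define E where "E = (\<Union>i\<in>A. \<Union>k\<in>Poly_Mapping.keys (f i). range (Poly_Mapping.lookup k))"
  have "finite E" using assms by (auto simp: E_def)
  then have "Poly_Mapping.keys (f i) \<subseteq> exponent_box (Max (insert 0 E))" if "i \<in> A" for i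
    using that by (auto simp: exponent_box_def E_def intro!: Max_ge)
  then show ?thesis by (rule that)
qed

lemma lookup_const_mult:
  fixes g :: "('n, 'k::Fields.field) mpoly"
  shows "Poly_Mapping.lookup (Poly_Mapping.single 0 c * g) k = c * Poly_Mapping.lookup g k"
  by (simp add: Poly_Mapping.map.rep_eq when_def flip: mult_map_scale_conv_mult)

text \<open>There are (N+1)^(n+1) products of powers with exponents at most N, while all their
  monomials lie in a box whose number of points grows only like N^n. For large N the products are
  therefore linearly dependent.\<close>

lemma algebraically_dependent:
  fixes f :: "nat \<Rightarrow> ('n::{finite,linorder}, 'k::Fields.field) mpoly"
  defines "n \<equiv> CARD('n)"
  obtains A c where "finite A" "A \<noteq> {}" "A \<subseteq> Pi\<^sub>E {..<Suc n} (\<lambda>_. UNIV)" "\<And>\<alpha>. \<alpha> \<in> A \<Longrightarrow> c \<alpha> \<noteq> 0"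
    "(\<Sum>\<alpha>\<in>A. Poly_Mapping.single 0 (c \<alpha>) * (\<Prod>i<Suc n. f i ^ \<alpha> i)) = 0"
proof -
  obtain D where D: "\<And>i. i < Suc n \<Longrightarrow> Poly_Mapping.keys (f i) \<subseteq> exponent_box D"
    using exponent_box_bound[of "{..<Suc n}" f] by auto
  \<comment> \<open>This choice gives (1 + (n+1)ND)^n \<le> ((1 + (n+1)D)(N+1))^n = N (N+1)^n <
    (N+1)^(n+1), which is the required comparison of cardinalities.\<close>
  define N where "N = Suc (Suc n * D) ^ n"
  define I :: "(nat \<Rightarrow> nat) set" where "I = Pi\<^sub>E {..<Suc n} (\<lambda>_. {..N})"
  define B :: "('n \<Rightarrow>\<^sub>0 nat) set" where "B = exponent_box (Suc n * (N * D))"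
  define g where "g \<alpha> = (\<Prod>i<Suc n. f i ^ \<alpha> i)" for \<alpha>
  have finI: "finite I" unfolding I_def by (rule finite_PiE) auto
  have "card B \<le> Suc (Suc n * (N * D)) ^ n"
    using card_exponent_box_le[where ?'n = 'n] by (simp only: B_def n_def)
  also have "\<dots> \<le> (Suc (Suc n * D) * Suc N) ^ n"
    by (rule power_mono) (auto simp: algebra_simps)
  also have "\<dots> = N * Suc N ^ n" by (simp only: power_mult_distrib N_def)
  also have "\<dots> < Suc N ^ Suc n" by simp
  also have "\<dots> = card I" by (simp add: I_def card_PiE)
  finally have "card B < card I" .
  moreover have "finite B" unfolding B_def by (rule finite_exponent_box)
  ultimately have "\<exists>c. (\<exists>\<alpha>\<in>I. c \<alpha> \<noteq> 0) \<and> (\<forall>b\<in>B. (\<Sum>\<alpha>\<in>I. c \<alpha> * Poly_Mapping.lookup (g \<alpha>) b) = 0)"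
    by (intro exists_nontrivial_solution finI)
  then obtain c where "(\<exists>\<alpha>\<in>I. c \<alpha> \<noteq> 0) \<and> (\<forall>b\<in>B. (\<Sum>\<alpha>\<in>I. c \<alpha> * Poly_Mapping.lookup (g \<alpha>) b) = 0)"
    by (rule exE)
  then have c: "\<exists>\<alpha>\<in>I. c \<alpha> \<noteq> 0"
    "\<And>b. b \<in> B \<Longrightarrow> (\<Sum>\<alpha>\<in>I. c \<alpha> * Poly_Mapping.lookup (g \<alpha>) b) = 0"
    by simp_all
  have keys: "Poly_Mapping.keys (g \<alpha>) \<subseteq> B" if "\<alpha> \<in> I" for \<alpha>
  proof -
    have "Poly_Mapping.keys (f i ^ \<alpha> i) \<subseteq> exponent_box (N * D)" if "i < Suc n" for i
    proof -
      have "\<alpha> i \<le> N" using \<open>\<alpha> \<in> I\<close> that by (auto simp: I_def)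
      then show ?thesis
        using keys_power_exponent_box[OF D[OF that], of "\<alpha> i"]
          exponent_box_mono[of "\<alpha> i * D" "N * D"] by fastforce
    qed
    then show ?thesis
      using keys_prod_exponent_box[of "{..<Suc n}" "\<lambda>i. f i ^ \<alpha> i" "N * D"]
      unfolding B_def g_def by (metis card_lessThan finite_lessThan lessThan_iff)
  qed
  have zero: "(\<Sum>\<alpha>\<in>I. Poly_Mapping.single 0 (c \<alpha>) * g \<alpha>) = 0"
  proof (rule poly_mapping_eqI)
    fix b
    show "Poly_Mapping.lookup (\<Sum>\<alpha>\<in>I. Poly_Mapping.single 0 (c \<alpha>) * g \<alpha>) b = Poly_Mapping.lookup 0 b"
    \<comment> \<open>Inside the box the coefficient vanishes by the choice of \<open>c\<close>;
      outside it no product has this monomial.\<close>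
    proof (cases "b \<in> B")
      case True
      then show ?thesis using c(2) by (simp only: lookup_sum lookup_const_mult lookup_zero)
    next
      case False
      then have "Poly_Mapping.lookup (g \<alpha>) b = 0" if "\<alpha> \<in> I" for \<alpha>
        using keys[OF that] by (metis in_keys_iff subsetD)
      then show ?thesis by (simp only: lookup_sum lookup_const_mult lookup_zero) simp
    qed
  qed
  \<comment> \<open>Discarding the zero coefficients leaves a nonempty relation all of whose
    coefficients are nonzero.\<close>
  have "(\<Sum>\<alpha>\<in>{\<alpha>\<in>I. c \<alpha> \<noteq> 0}. Poly_Mapping.single 0 (c \<alpha>) * g \<alpha>) =
      (\<Sum>\<alpha>\<in>I. Poly_Mapping.single 0 (c \<alpha>) * g \<alpha>)"
    by (rule sum.mono_neutral_left) (use finI in auto)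
  also note zero
  finally have rel: "(\<Sum>\<alpha>\<in>{\<alpha>\<in>I. c \<alpha> \<noteq> 0}. Poly_Mapping.single 0 (c \<alpha>) * (\<Prod>i<Suc n. f i ^ \<alpha> i)) = 0"
    by (simp only: g_def)
  have sub: "{\<alpha>\<in>I. c \<alpha> \<noteq> 0} \<subseteq> Pi\<^sub>E {..<Suc n} (\<lambda>_. UNIV)"
    unfolding I_def by (rule subset_trans[OF Collect_restrict PiE_mono]) simp
  have fin: "finite {\<alpha>\<in>I. c \<alpha> \<noteq> 0}" using finI by simp
  have ne: "{\<alpha>\<in>I. c \<alpha> \<noteq> 0} \<noteq> {}" using c(1) by blast
  show ?thesis by (rule that[OF fin ne sub _ rel]) simp
qed

text \<open>Each step peels off the lowest power of \<open>f j\<close>: it may be cancelled since \<open>f j \<notin> Q j\<close>, and the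
  terms with a higher power vanish modulo \<open>Q (Suc j)\<close>.\<close>

lemma relation_along_prime_chain:
  fixes Q :: "nat \<Rightarrow> 'a::comm_ring_1 set" and c :: "(nat \<Rightarrow> nat) \<Rightarrow> 'a"
  assumes prime: "\<And>i. i \<le> N \<Longrightarrow> primeideal (Q i) ring_of"
    and chain: "\<And>i. i < N \<Longrightarrow> Q i \<subseteq> Q (Suc i)"
    and f: "\<And>i. i < N \<Longrightarrow> f i \<in> Q (Suc i) - Q i"
    and A: "finite A" "A \<noteq> {}" "A \<subseteq> Pi\<^sub>E {..<N} (\<lambda>_. UNIV)"
    and rel: "(\<Sum>\<alpha>\<in>A. c \<alpha> * (\<Prod>i<N. f i ^ \<alpha> i)) = 0"
  shows "\<exists>\<alpha>\<in>A. c \<alpha> \<in> Q N"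
proof -
  have add: "a + b \<in> Q i" if "i \<le> N" "a \<in> Q i" "b \<in> Q i" for a b i
    using prime[OF that(1)] that by (auto simp: primeideal_ring_of_iff ideal_ring_of_iff)
  have mult: "r * a \<in> Q i" if "i \<le> N" "a \<in> Q i" for a r i
    using prime[OF that(1)] that by (auto simp: primeideal_ring_of_iff ideal_ring_of_iff)
  \<comment> \<open>Invariant: the surviving exponents agree in the first \<open>j\<close>
    coordinates, and the relation, stripped of the factors \<open>f 0\<close>, ...,
    \<open>f (j - 1)\<close>, lies in \<open>Q j\<close>.\<close>
  have step: "\<exists>B\<subseteq>A. B \<noteq> {} \<and> (\<forall>\<alpha>\<in>B. \<forall>\<beta>\<in>B. \<forall>i<j. \<alpha> i = \<beta> i) \<and>
      (\<Sum>\<alpha>\<in>B. c \<alpha> * (\<Prod>i\<in>{j..<N}. f i ^ \<alpha> i)) \<in> Q j" if "j \<le> N" for j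
    using that
  proof (induction j)
    case 0
    have "0 \<in> Q 0" using prime[of 0] by (simp add: primeideal_ring_of_iff ideal_ring_of_iff)
    then show ?case using A rel by (intro exI[of _ A]) (auto simp: lessThan_atLeast0)
  next
    case (Suc j)
    then have j: "j < N" "j \<le> N" "Suc j \<le> N" by auto
    obtain B where B: "B \<subseteq> A" "B \<noteq> {}" "\<forall>\<alpha>\<in>B. \<forall>\<beta>\<in>B. \<forall>i<j. \<alpha> i = \<beta> i"
      "(\<Sum>\<alpha>\<in>B. c \<alpha> * (\<Prod>i\<in>{j..<N}. f i ^ \<alpha> i)) \<in> Q j"
      using Suc by auto
    have finB: "finite B" using B(1) A(1) finite_subset by blast
    \<comment> \<open>The lowest power of \<open>f j\<close> that occurs; the exponents attaining it
      form \<open>C\<close> and survive the step.\<close>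
    define m where "m = Min ((\<lambda>\<alpha>. \<alpha> j) ` B)"
    have m_le: "m \<le> \<alpha> j" if "\<alpha> \<in> B" for \<alpha> using that finB by (simp add: m_def)
    define C where "C = {\<alpha>\<in>B. \<alpha> j = m}"
    have "m \<in> (\<lambda>\<alpha>. \<alpha> j) ` B" unfolding m_def using finB B(2) by (intro Min_in) auto
    then have C: "C \<noteq> {}" "C \<subseteq> B" by (auto simp: C_def)
    define g where "g \<alpha> = c \<alpha> * (\<Prod>i\<in>{Suc j..<N}. f i ^ \<alpha> i)" for \<alpha>
    have "c \<alpha> * (\<Prod>i\<in>{j..<N}. f i ^ \<alpha> i) = f j ^ m * (f j ^ (\<alpha> j - m) * g \<alpha>)" if "\<alpha> \<in> B" for \<alpha>
    proof -
      have "f j ^ \<alpha> j = f j ^ m * f j ^ (\<alpha> j - m)"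
        using m_le[OF that] by (simp flip: power_add)
      then show ?thesis using j by (simp add: g_def prod.atLeast_Suc_lessThan mult_ac)
    qed
    then have "(\<Sum>\<alpha>\<in>B. c \<alpha> * (\<Prod>i\<in>{j..<N}. f i ^ \<alpha> i)) = f j ^ m * (\<Sum>\<alpha>\<in>B. f j ^ (\<alpha> j - m) * g \<alpha>)"
      by (simp add: sum_distrib_left)
    then have "f j ^ m * (\<Sum>\<alpha>\<in>B. f j ^ (\<alpha> j - m) * g \<alpha>) \<in> Q j" using B(4) by simp
    moreover have "f j ^ m \<notin> Q j" using prime_power_mem[OF prime[OF j(2)]] f[OF j(1)] by blast
    ultimately have "(\<Sum>\<alpha>\<in>B. f j ^ (\<alpha> j - m) * g \<alpha>) \<in> Q j"
      using prime[OF j(2)] by (auto simp: primeideal_ring_of_iff)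
    then have "(\<Sum>\<alpha>\<in>B. f j ^ (\<alpha> j - m) * g \<alpha>) \<in> Q (Suc j)" using chain[OF j(1)] by auto
    also have "(\<Sum>\<alpha>\<in>B. f j ^ (\<alpha> j - m) * g \<alpha>) =
        (\<Sum>\<alpha>\<in>B - C. f j ^ (\<alpha> j - m) * g \<alpha>) + (\<Sum>\<alpha>\<in>C. f j ^ (\<alpha> j - m) * g \<alpha>)"
      by (rule sum.subset_diff[OF C(2) finB])
    also have "(\<Sum>\<alpha>\<in>C. f j ^ (\<alpha> j - m) * g \<alpha>) = (\<Sum>\<alpha>\<in>C. g \<alpha>)"
      by (rule sum.cong) (auto simp: C_def)
    also have "(\<Sum>\<alpha>\<in>B - C. f j ^ (\<alpha> j - m) * g \<alpha>) = (\<Sum>\<alpha>\<in>B - C. f j ^ (\<alpha> j - m - 1) * g \<alpha>) * f j"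
      unfolding sum_distrib_right
    proof (rule sum.cong)
      fix \<alpha> assume "\<alpha> \<in> B - C"
      then have "\<alpha> j - m = Suc (\<alpha> j - m - 1)" using m_le[of \<alpha>] by (auto simp: C_def)
      then have "f j ^ (\<alpha> j - m) = f j ^ (\<alpha> j - m - 1) * f j" by (metis power_Suc2)
      then show "f j ^ (\<alpha> j - m) * g \<alpha> = f j ^ (\<alpha> j - m - 1) * g \<alpha> * f j" by (simp add: mult_ac)
    qed simp
    finally have sum: "(\<Sum>\<alpha>\<in>B - C. f j ^ (\<alpha> j - m - 1) * g \<alpha>) * f j + (\<Sum>\<alpha>\<in>C. g \<alpha>) \<in> Q (Suc j)" .
    have "(- (\<Sum>\<alpha>\<in>B - C. f j ^ (\<alpha> j - m - 1) * g \<alpha>)) * f j \<in> Q (Suc j)"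
      by (rule mult[OF j(3)]) (use f[OF j(1)] in simp)
    from add[OF j(3) this sum] have "(\<Sum>\<alpha>\<in>C. g \<alpha>) \<in> Q (Suc j)" by simp
    moreover have "\<forall>\<alpha>\<in>C. \<forall>\<beta>\<in>C. \<forall>i<Suc j. \<alpha> i = \<beta> i"
      using B(3) by (auto simp: C_def less_Suc_eq)
    ultimately show ?case
      using B(1) C by (intro exI[of _ C]) (auto simp: g_def)
  qed
  obtain B where B: "B \<subseteq> A" "B \<noteq> {}" "\<forall>\<alpha>\<in>B. \<forall>\<beta>\<in>B. \<forall>i<N. \<alpha> i = \<beta> i" "(\<Sum>\<alpha>\<in>B. c \<alpha>) \<in> Q N"
    using step[of N] by auto
  obtain \<alpha> where \<alpha>: "\<alpha> \<in> B" using B(2) by auto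
  \<comment> \<open>Exponents are extensional functions, so agreement on all indices below
    \<open>N\<close> leaves only one, and its coefficient is the whole sum.\<close>
  have "\<beta> = \<alpha>" if "\<beta> \<in> B" for \<beta>
  proof (rule PiE_ext)
    show "\<beta> \<in> Pi\<^sub>E {..<N} (\<lambda>_. UNIV)" "\<alpha> \<in> Pi\<^sub>E {..<N} (\<lambda>_. UNIV)"
      using that \<alpha> B(1) A(3) by blast+
    show "\<beta> i = \<alpha> i" if "i \<in> {..<N}" for i
      using B(3) \<open>\<beta> \<in> B\<close> \<alpha> that by blast
  qed
  then have "B = {\<alpha>}" using \<alpha> by blast
  then show ?thesis using B(1,4) by auto
qed

text \<open>Pick \<open>f i\<close> in \<open>Q (Suc i)\<close> outside \<open>Q i\<close>. In a
  chain of n + 1 steps, a relation among n + 1 such polynomials with nonzero constant coefficients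
  would place one of these units in a prime ideal.\<close>

lemma prime_chain_length_le:
  fixes Q :: "nat \<Rightarrow> ('n::{finite,linorder}, 'k::Fields.field) mpoly set"
  assumes prime: "\<And>i. i \<le> N \<Longrightarrow> primeideal (Q i) ring_of" and chain: "\<And>i. i < N \<Longrightarrow> Q i \<subset> Q (Suc i)"
  shows "N \<le> CARD('n)"
proof (rule ccontr)
  assume "\<not> N \<le> CARD('n)"
  then have N: "Suc CARD('n) \<le> N" by simp
  have "\<forall>i. \<exists>g. i < N \<longrightarrow> g \<in> Q (Suc i) - Q i" using chain by blast
  then obtain f where f: "\<And>i. i < N \<Longrightarrow> f i \<in> Q (Suc i) - Q i" by metis
  obtain A c where A: "finite A" "A \<noteq> {}" "A \<subseteq> Pi\<^sub>E {..<Suc CARD('n)} (\<lambda>_. UNIV)"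
    "\<And>\<alpha>. \<alpha> \<in> A \<Longrightarrow> c \<alpha> \<noteq> 0"
    "(\<Sum>\<alpha>\<in>A. Poly_Mapping.single 0 (c \<alpha>) * (\<Prod>i<Suc CARD('n). f i ^ \<alpha> i)) = 0"
    using algebraically_dependent[of f] by blast
  have "\<exists>\<alpha>\<in>A. Poly_Mapping.single 0 (c \<alpha>) \<in> Q (Suc CARD('n))"
    by (rule relation_along_prime_chain[OF _ _ _ A(1-3,5)]) (use N prime chain f in \<open>auto simp: psubset_eq\<close>)
  then obtain \<alpha> where \<alpha>: "\<alpha> \<in> A" "Poly_Mapping.single 0 (c \<alpha>) \<in> Q (Suc CARD('n))" by auto
  then have "Poly_Mapping.single 0 (inverse (c \<alpha>)) * Poly_Mapping.single 0 (c \<alpha>) \<in> Q (Suc CARD('n))"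
    using prime[OF N] by (simp add: primeideal_ring_of_iff ideal_ring_of_iff)
  then have "1 \<in> Q (Suc CARD('n))" using A(4)[OF \<alpha>(1)] by (simp add: mult_single)
  then show False using prime[OF N] by (simp add: primeideal_ring_of_iff)
qed

section \<open>Heights of primes generated by variables\<close>

lemma card_le_prime_height:
  fixes P :: "('n::{finite,linorder}, 'k::Fields.field) mpoly set"
  assumes P: "primeideal P ring_of" and sub: "weight_ideal S 1 \<subseteq> P"
  shows "enat (card S) \<le> prime_height P"
proof -
  obtain xs where xs: "set xs = S" "distinct xs" using finite_distinct_list[of S] by auto
  then have len: "length xs = card S" using distinct_card by fastforce
  \<comment> \<open>The chain starts at the zero ideal and adjoins the variables of \<open>S\<close>
    one at a time. Its last member is replaced by \<open>P\<close>, which keeps the last inclusion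
    strict because \<open>P\<close> contains all of P_S.\<close>
  define Q where "Q i = (if i = card S then P else weight_ideal (set (take i xs)) 1)" for i
  have "Q i \<subset> Q (Suc i)" if i: "i < card S" for i
  proof -
    have take: "set (take (Suc i) xs) = insert (xs ! i) (set (take i xs))"
      using i len by (simp add: take_Suc_conv_app_nth)
    have "xs ! i \<notin> set (take i xs)"
      using i len xs(2) by (auto simp: in_set_conv_nth nth_eq_iff_index_eq)
    then have "(weight_ideal (set (take i xs)) 1 :: ('n, 'k) mpoly set) \<subset> weight_ideal (set (take (Suc i) xs)) 1"
      unfolding psubset_eq take using weight_ideal_mono Var_mem_weight_ideal by blast
    also have "\<dots> \<subseteq> Q (Suc i)"
      using sub len xs(1) by (auto simp: Q_def)
    finally show ?thesis using i by (simp add: Q_def)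
  qed
  moreover have "\<forall>i\<le>card S. primeideal (Q i) ring_of"
    using P primeideal_weight_ideal by (auto simp: Q_def simp del: One_nat_def)
  moreover have "Q (card S) = P" by (simp add: Q_def)
  ultimately show ?thesis
    unfolding prime_height_def by (intro SUP_upper) blast
qed

text \<open>A chain below the ideal of the variables in \<open>S\<close> can be prolonged by adjoining the remaining
  variables one at a time.\<close>

lemma prime_height_weight_ideal_le:
  "prime_height (weight_ideal S 1 :: ('n::{finite,linorder}, 'k::Fields.field) mpoly set) \<le> enat (card S)"
  unfolding prime_height_def
proof (rule SUP_least)
  let ?W = "\<lambda>S. weight_ideal S 1 :: ('n, 'k) mpoly set"
  fix k assume "k \<in> {k. \<exists>Q. (\<forall>i\<le>k. primeideal (Q i) ring_of) \<and> (\<forall>i<k. Q i \<subset> Q (Suc i)) \<and> Q k = ?W S}"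
  then obtain Q where Q: "\<forall>i\<le>k. primeideal (Q i) ring_of" "\<forall>i<k. Q i \<subset> Q (Suc i)" "Q k = ?W S"
    by blast
  obtain xs where xs: "set xs = - S" "distinct xs" using finite_distinct_list[of "- S"] by auto
  then have len: "length xs = card (- S)" using distinct_card by fastforce
  \<comment> \<open>Both branches agree at \<open>i = k\<close>, where no variable has been adjoined
    yet and \<open>Q k\<close> is P_S.\<close>
  define Q' where "Q' i = (if i \<le> k then Q i else ?W (S \<union> set (take (i - k) xs)))" for i
  have "Q' i \<subset> Q' (Suc i)" if i: "i < k + card (- S)" for i
  proof (cases "i < k")
    case True
    then show ?thesis using Q(2) by (simp add: Q'_def)
  next
    case False
    then have "Q' i = ?W (S \<union> set (take (i - k) xs))" using Q(3) by (cases "i = k") (auto simp: Q'_def)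
    moreover have "i - k < length xs" using i len False by simp
    then have "set (take (Suc i - k) xs) = insert (xs ! (i - k)) (set (take (i - k) xs))"
      using False by (simp add: take_Suc_conv_app_nth Suc_diff_le)
    then have "Q' (Suc i) = ?W (insert (xs ! (i - k)) (S \<union> set (take (i - k) xs)))"
      using False by (simp add: Q'_def)
    moreover have "xs ! (i - k) \<notin> S" using \<open>i - k < length xs\<close> xs(1) nth_mem by fastforce
    moreover have "xs ! (i - k) \<notin> set (take (i - k) xs)"
      using \<open>i - k < length xs\<close> xs(2) by (auto simp: in_set_conv_nth nth_eq_iff_index_eq)
    ultimately show ?thesis
      unfolding psubset_eq using weight_ideal_mono Var_mem_weight_ideal by (metis Un_iff insertI1 subset_insertI)
  qed
  moreover have "primeideal (Q' i) ring_of" for i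
    using Q(1) primeideal_weight_ideal by (auto simp: Q'_def simp del: One_nat_def)
  \<comment> \<open>The prolonged chain has k + (n - |S|) steps; the bound n on its length leaves k
    \<le> |S|.\<close>
  ultimately have "k + card (- S) \<le> CARD('n)" by (intro prime_chain_length_le)
  moreover have "CARD('n) = card S + card (- S)"
    using card_Un_disjoint[of S "- S"] by (simp add: Compl_partition)
  ultimately show "enat k \<le> enat (card S)" by simp
qed

section \<open>Squarefree monomial ideals and vertex covers\<close>

text \<open>A cover of the hypergraph whose edges are the supports of the exponents in
  \<open>M\<close>.\<close>

definition vertex_cover :: "('n \<Rightarrow>\<^sub>0 nat) set \<Rightarrow> 'n set \<Rightarrow> bool" where
  "vertex_cover M S \<longleftrightarrow> (\<forall>m\<in>M. 1 \<le> weight S m)"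

definition min_covers :: "('n \<Rightarrow>\<^sub>0 nat) set \<Rightarrow> 'n set set" where
  "min_covers M = {S. vertex_cover M S \<and> (\<forall>T. T \<subseteq> S \<longrightarrow> vertex_cover M T \<longrightarrow> T = S)}"

lemma ex_min_cover:
  fixes S :: "'n::finite set"
  assumes "vertex_cover M S"
  obtains T where "T \<in> min_covers M" "T \<subseteq> S"
proof -
  have "\<exists>T\<in>{T. vertex_cover M T}. T \<subseteq> S \<and> (\<forall>U\<in>{T. vertex_cover M T}. U \<subseteq> T \<longrightarrow> T = U)"
    by (rule finite_has_minimal2) (use assms in auto)
  then show ?thesis using that by (auto simp: min_covers_def)
qed

text \<open>The exponent of the product of all variables outside \<open>S\<close>. This monomial is
  not in P_S, so it becomes a unit in the localization there; it serves as denominator and as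
  annihilator witness.\<close>

definition complement_exponent :: "'n set \<Rightarrow> ('n::finite \<Rightarrow>\<^sub>0 nat)" where
  "complement_exponent S = (\<Sum>j\<in>- S. Poly_Mapping.single j 1)"

lemma lookup_complement_exponent:
  "Poly_Mapping.lookup (complement_exponent S) i = (if i \<in> S then 0 else 1)"
  by (simp add: complement_exponent_def lookup_sum lookup_single when_def)

lemma complement_exponent_notin:
  "(monom_of (complement_exponent S) :: ('n::{finite,linorder}, 'k::Fields.field) mpoly) \<notin> weight_ideal S 1"
  by (simp add: weight_ideal_def weight_def lookup_complement_exponent)

lemma complement_exponent_power_notin:
  "(monom_of (complement_exponent S) ^ r :: ('n::{finite,linorder}, 'k::Fields.field) mpoly) \<notin> weight_ideal S 1"
  using prime_power_mem[OF primeideal_weight_ideal] complement_exponent_notin by blast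

text \<open>\<open>nonempty\<close> expresses that the ideal is nonzero, and
  \<open>zero_notin\<close> that the constant monomial 1 is not among the generators, so that the
  ideal is proper.\<close>

locale squarefree_exponents =
  fixes M :: "('n::{finite,linorder} \<Rightarrow>\<^sub>0 nat) set" and I :: "('n, 'k::Fields.field) mpoly set"
  assumes I_def: "I = Idl\<^bsub>ring_of\<^esub> (monom_of ` M)"
    and squarefree: "\<And>m i. m \<in> M \<Longrightarrow> Poly_Mapping.lookup m i \<le> 1"
    and nonempty: "M \<noteq> {}" and zero_notin: "0 \<notin> M"
begin

section \<open>Minimal primes, prime decomposition and associated primes\<close>

lemma ideal_I: "ideal I ring_of"
  unfolding I_def by (rule genideal_ring_of_ideal)

lemma monom_of_mem_I: "m \<in> M \<Longrightarrow> monom_of m \<in> I"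
  unfolding I_def by (rule subsetD[OF subset_genideal]) simp

lemma I_subset_weight_ideal_iff: "I \<subseteq> weight_ideal S 1 \<longleftrightarrow> vertex_cover M S"
proof
  assume "I \<subseteq> weight_ideal S 1"
  then have "(monom_of m :: ('n, 'k) mpoly) \<in> weight_ideal S 1" if "m \<in> M" for m
    using monom_of_mem_I[OF that] by blast
  then show "vertex_cover M S" by (simp add: vertex_cover_def weight_ideal_def)
next
  assume "vertex_cover M S"
  then show "I \<subseteq> weight_ideal S 1"
    unfolding I_def by (intro genideal_subset ideal_weight_ideal) (auto simp: vertex_cover_def weight_ideal_def)
qed

lemma vertex_cover_UNIV: "vertex_cover M UNIV"
  unfolding vertex_cover_def
proof
  fix m assume "m \<in> M"
  then have "m \<noteq> 0" using zero_notin by auto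
  then obtain i where "Poly_Mapping.lookup m i \<noteq> 0" by (metis poly_mapping_eqI lookup_zero)
  then show "1 \<le> weight UNIV m" unfolding one_le_weight_iff by blast
qed

lemma min_covers_nonempty: "min_covers M \<noteq> {}"
  using ex_min_cover[OF vertex_cover_UNIV] by blast

text \<open>A generator is a product of powers of variables, so a prime containing it contains a
  variable that really occurs in it.\<close>

lemma vertex_cover_of_prime:
  assumes Q: "primeideal Q ring_of" and sub: "I \<subseteq> Q"
  shows "vertex_cover M {i. Var i \<in> Q}"
  unfolding vertex_cover_def
proof
  fix m assume "m \<in> M"
  then have "(\<Prod>i\<in>UNIV. Var i ^ Poly_Mapping.lookup m i) \<in> Q"
    using monom_of_mem_I sub by (auto simp: monom_of_eq_prod_Var)
  then have "\<exists>i\<in>UNIV. Var i ^ Poly_Mapping.lookup m i \<in> Q" by (intro prime_prod_mem[OF Q]) simp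
  then obtain i where i: "Var i ^ Poly_Mapping.lookup m i \<in> Q" by blast
  \<comment> \<open>With exponent 0 the factor would be 1, which no prime contains.\<close>
  then have "Poly_Mapping.lookup m i \<noteq> 0" using Q by (auto simp: primeideal_ring_of_iff intro: ccontr)
  moreover have "Var i \<in> Q" using prime_power_mem[OF Q i] .
  ultimately show "1 \<le> weight {i. Var i \<in> Q} m" unfolding one_le_weight_iff by blast
qed

lemma prime_contains_min_cover:
  assumes "primeideal Q ring_of" "I \<subseteq> Q"
  obtains T where "T \<in> min_covers M" "weight_ideal T 1 \<subseteq> Q"
proof -
  obtain T where T: "T \<in> min_covers M" "T \<subseteq> {i. Var i \<in> Q}"
    using ex_min_cover[OF vertex_cover_of_prime[OF assms]] .
  have "weight_ideal T 1 \<subseteq> Q"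
    using assms(1) T(2) by (intro weight_ideal_subset_prime) (auto simp: primeideal_ring_of_iff)
  with T show ?thesis using that by blast
qed

lemma min_cover_weight_ideal_subset:
  assumes "S \<in> min_covers M" "T \<in> min_covers M"
    and "(weight_ideal T 1 :: ('n, 'k) mpoly set) \<subseteq> weight_ideal S 1"
  shows "T = S"
  using assms(1,2) assms(3)[unfolded weight_ideal_subset_iff] by (auto simp: min_covers_def)

text \<open>Every prime over \<open>I\<close> contains P_T for some minimal cover T, and the primes
  of distinct minimal covers are incomparable.\<close>

lemma minimal_primes_eq: "minimal_primes I = (\<lambda>S. weight_ideal S 1) ` min_covers M"
proof (intro equalityI subsetI)
  fix P assume "P \<in> minimal_primes I"
  then have P: "primeideal P ring_of" "I \<subseteq> P"
    and min: "\<And>Q. primeideal Q ring_of \<Longrightarrow> I \<subseteq> Q \<Longrightarrow> Q \<subseteq> P \<Longrightarrow> Q = P"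
    by (auto simp: minimal_primes_def)
  obtain T where T: "T \<in> min_covers M" "weight_ideal T 1 \<subseteq> P"
    using prime_contains_min_cover[OF P] .
  then have "I \<subseteq> weight_ideal T 1" unfolding I_subset_weight_ideal_iff by (simp add: min_covers_def)
  then have "weight_ideal T 1 = P" by (intro min primeideal_weight_ideal T)
  then show "P \<in> (\<lambda>S. weight_ideal S 1) ` min_covers M" using T(1) by blast
next
  fix P :: "('n, 'k) mpoly set" assume "P \<in> (\<lambda>S. weight_ideal S 1) ` min_covers M"
  then obtain S where S: "S \<in> min_covers M" "P = weight_ideal S 1" by auto
  have "I \<subseteq> P" using S unfolding S(2) I_subset_weight_ideal_iff by (simp add: min_covers_def)
  moreover have "Q = P" if Q: "primeideal Q ring_of" "I \<subseteq> Q" "Q \<subseteq> P" for Q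
  proof -
    obtain T where T: "T \<in> min_covers M" "weight_ideal T 1 \<subseteq> Q"
      using prime_contains_min_cover[OF Q(1,2)] .
    have "(weight_ideal T 1 :: ('n, 'k) mpoly set) \<subseteq> weight_ideal S 1"
      using T(2) Q(3) S(2) by (metis subset_trans)
    from min_cover_weight_ideal_subset[OF S(1) T(1) this] show "Q = P"
      using T(2) Q(3) S(2) by (metis subset_antisym)
  qed
  ultimately show "P \<in> minimal_primes I"
    unfolding minimal_primes_def S(2) using primeideal_weight_ideal by blast
qed

text \<open>Removing \<open>i\<close> destroys the cover, so some generator meets \<open>S\<close>
  only in \<open>i\<close>; square-freeness then makes the exponent there exactly 1.\<close>

lemma min_cover_witness:
  assumes S: "S \<in> min_covers M" and i: "i \<in> S"
  obtains m where "m \<in> M" "weight S m = 1" "Poly_Mapping.lookup m i = 1"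
    "\<And>j. j \<in> S \<Longrightarrow> j \<noteq> i \<Longrightarrow> Poly_Mapping.lookup m j = 0"
proof -
  have "\<not> vertex_cover M (S - {i})" using S i by (auto simp: min_covers_def)
  then obtain m where m: "m \<in> M" "weight (S - {i}) m = 0"
    by (auto simp: vertex_cover_def Suc_le_eq)
  then have zero: "\<And>j. j \<in> S \<Longrightarrow> j \<noteq> i \<Longrightarrow> Poly_Mapping.lookup m j = 0"
    by (auto simp: weight_def)
  have "weight S m = Poly_Mapping.lookup m i + weight (S - {i}) m"
    unfolding weight_def using i by (intro sum.remove) auto
  moreover have "1 \<le> weight S m" using S m(1) by (auto simp: min_covers_def vertex_cover_def)
  moreover have "Poly_Mapping.lookup m i \<le> 1" by (rule squarefree[OF m(1)])
  ultimately have "weight S m = 1" "Poly_Mapping.lookup m i = 1" using m(2) by simp_all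
  with m(1) zero show ?thesis using that by blast
qed

text \<open>The generator meeting \<open>S\<close> only in \<open>i\<close> divides the monomial:
  \<open>k\<close> supplies the variable \<open>i\<close>, and the complement supplies all variables
  outside \<open>S\<close>. Locally at P_S, each variable of \<open>S\<close> thus lies in
  \<open>I\<close>.\<close>

lemma monom_of_complement_mem_I:
  assumes S: "S \<in> min_covers M" and i: "i \<in> S" "Poly_Mapping.lookup k i \<noteq> 0"
  shows "monom_of (k + complement_exponent S) \<in> I"
proof -
  obtain m where m: "m \<in> M" "Poly_Mapping.lookup m i = 1"
    "\<And>j. j \<in> S \<Longrightarrow> j \<noteq> i \<Longrightarrow> Poly_Mapping.lookup m j = 0"
    using min_cover_witness[OF S i(1)] by metis
  have "Poly_Mapping.lookup m j \<le> Poly_Mapping.lookup (k + complement_exponent S) j" for j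
    using m i squarefree[OF m(1), of j]
    by (cases "j = i"; cases "j \<in> S") (auto simp: lookup_add lookup_complement_exponent)
  then show ?thesis
    unfolding I_def monom_of_mem_Idl exponent_le_iff using m(1) by blast
qed

text \<open>The prime decomposition of a square-free monomial ideal as the intersection of its
  minimal primes.\<close>

lemma mem_I_iff: "f \<in> I \<longleftrightarrow> (\<forall>S\<in>min_covers M. f \<in> weight_ideal S 1)"
proof
  assume "f \<in> I"
  then show "\<forall>S\<in>min_covers M. f \<in> weight_ideal S 1"
    using I_subset_weight_ideal_iff by (auto simp: min_covers_def)
next
  assume f: "\<forall>S\<in>min_covers M. f \<in> weight_ideal S 1"
  have "\<exists>m\<in>M. \<exists>l. k = m + l" if k: "k \<in> Poly_Mapping.keys f" for k
  proof (rule ccontr)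
    assume "\<not> (\<exists>m\<in>M. \<exists>l. k = m + l)"
    then have *: "\<exists>i. Poly_Mapping.lookup k i < Poly_Mapping.lookup m i" if "m \<in> M" for m
      using that by (simp add: exponent_le_iff) (meson not_le)
    \<comment> \<open>If no generator divides the monomial \<open>k\<close>, each generator has a
      variable that is absent from \<open>k\<close>, by square-freeness. The absent variables then
      form a cover, and \<open>k\<close> has weight 0 on any minimal cover inside it.\<close>
    let ?Z = "{i. Poly_Mapping.lookup k i = 0}"
    have "vertex_cover M ?Z"
      unfolding vertex_cover_def
    proof
      fix m assume "m \<in> M"
      with * obtain i where i: "Poly_Mapping.lookup k i < Poly_Mapping.lookup m i" by blast
      then have "Poly_Mapping.lookup k i = 0" using squarefree[OF \<open>m \<in> M\<close>, of i] by simp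
      with i show "1 \<le> weight ?Z m" unfolding one_le_weight_iff by auto
    qed
    then obtain S where S: "S \<in> min_covers M" "S \<subseteq> ?Z" using ex_min_cover by blast
    then have "weight S k = 0" by (auto simp: weight_def)
    moreover have "1 \<le> weight S k" using f S(1) k by (auto simp: weight_ideal_def)
    ultimately show False by simp
  qed
  then show "f \<in> I" unfolding I_def Idl_monom_of by blast
qed

text \<open>By the prime decomposition, the annihilator of the class of \<open>f\<close> is the
  intersection of those P_S that do not contain \<open>f\<close>. A prime of this form contains one
  of these finitely many P_S, hence equals it.\<close>

lemma associated_primes_eq: "associated_primes I = (\<lambda>S. weight_ideal S 1) ` min_covers M"
proof (intro equalityI subsetI)
  fix Q assume "Q \<in> associated_primes I"
  then obtain f where Q: "primeideal Q ring_of" "Q = {r. r * f \<in> I}"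
    by (auto simp: associated_primes_def)
  let ?C = "{S \<in> min_covers M. f \<notin> weight_ideal S 1}"
  have "\<exists>S\<in>?C. weight_ideal S 1 \<subseteq> Q"
  proof (rule ccontr)
    assume "\<not> (\<exists>S\<in>?C. weight_ideal S 1 \<subseteq> Q)"
    then have "\<forall>S\<in>?C. \<exists>g. g \<in> weight_ideal S 1 \<and> g \<notin> Q" by blast
    from bchoice[OF this] obtain g where "\<forall>S\<in>?C. g S \<in> weight_ideal S 1 \<and> g S \<notin> Q"
      by (rule exE)
    then have g: "g S \<in> weight_ideal S 1" "g S \<notin> Q" if "S \<in> ?C" for S
      using that by blast+
    \<comment> \<open>At each minimal cover either \<open>f\<close> itself or the factor
      \<open>g T\<close> provides the membership.\<close>
    have "(\<Prod>S\<in>?C. g S) * f \<in> weight_ideal T 1" if T: "T \<in> min_covers M" for T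
    proof (cases "f \<in> weight_ideal T 1")
      case True
      then show ?thesis using ideal_weight_ideal[of T 1, where ?'k = 'k] by (auto simp: ideal_ring_of_iff)
    next
      case False
      then have "T \<in> ?C" using T by simp
      then have "(\<Prod>S\<in>?C. g S) * f = ((\<Prod>S\<in>?C - {T}. g S) * f) * g T"
        by (subst prod.remove[of ?C T]) (simp_all add: mult_ac)
      moreover have "((\<Prod>S\<in>?C - {T}. g S) * f) * g T \<in> weight_ideal T 1"
        using ideal_weight_ideal[of T 1, where ?'k = 'k] g(1)[OF \<open>T \<in> ?C\<close>]
        unfolding ideal_ring_of_iff by blast
      ultimately show ?thesis by (simp only:)
    qed
    then have "(\<Prod>S\<in>?C. g S) \<in> Q" unfolding Q(2) mem_I_iff by simp
    then have "\<exists>S\<in>?C. g S \<in> Q" by (intro prime_prod_mem[OF Q(1)]) auto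
    then show False using g(2) by blast
  qed
  then obtain S where S: "S \<in> min_covers M" "f \<notin> weight_ideal S 1" "weight_ideal S 1 \<subseteq> Q" by auto
  have "Q \<subseteq> weight_ideal S 1"
  proof
    fix r assume "r \<in> Q"
    then have "f * r \<in> weight_ideal S 1"
      using S(1) unfolding Q(2) mem_I_iff by (simp add: mult.commute)
    then show "r \<in> weight_ideal S 1" by (rule weight_ideal_cancel[OF S(2)])
  qed
  with S show "Q \<in> (\<lambda>S. weight_ideal S 1) ` min_covers M" by blast
next
  fix Q :: "('n, 'k) mpoly set" assume "Q \<in> (\<lambda>S. weight_ideal S 1) ` min_covers M"
  then obtain S where S: "S \<in> min_covers M" "Q = weight_ideal S 1" by auto
  \<comment> \<open>The class of this monomial has annihilator exactly P_S.\<close>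
  let ?u = "monom_of (complement_exponent S) :: ('n, 'k) mpoly"
  have "r \<in> weight_ideal S 1" if "r * ?u \<in> I" for r
    using that S(1) weight_ideal_cancel[OF complement_exponent_notin, of S r 1]
    unfolding mem_I_iff by (simp add: mult.commute)
  moreover have "r * ?u \<in> I" if r: "r \<in> weight_ideal S 1" for r
    unfolding I_def Idl_monom_of
  proof (intro CollectI ballI)
    fix k assume "k \<in> Poly_Mapping.keys (r * ?u)"
    then obtain k' where k': "k' \<in> Poly_Mapping.keys r" "k = k' + complement_exponent S"
      unfolding keys_mult_monom_of by blast
    then have "weight S k' \<noteq> 0" using r by (auto simp: weight_ideal_def)
    then obtain i where "i \<in> S" "Poly_Mapping.lookup k' i \<noteq> 0" by (auto simp: weight_def)
    then have "monom_of k \<in> I" unfolding k'(2) by (rule monom_of_complement_mem_I[OF S(1)])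
    then show "\<exists>m\<in>M. \<exists>l. k = m + l" unfolding I_def monom_of_mem_Idl .
  qed
  ultimately have "Q = {r. r * ?u \<in> I}" unfolding S(2) by blast
  then show "Q \<in> associated_primes I"
    unfolding associated_primes_def S(2) using primeideal_weight_ideal by blast
qed

section \<open>Symbolic powers as intersections of weight ideals\<close>

lemma monom_of_mult_complement_mem_ideal_power:
  assumes S: "S \<in> min_covers M" and "r \<le> weight S k"
  shows "monom_of k * monom_of (complement_exponent S) ^ r \<in> ideal_power I r"
  using assms(2)
proof (induction r arbitrary: k)
  case 0
  then show ?case by (simp add: ideal_power_0)
next
  case (Suc r)
  then have "weight S k \<noteq> 0" by simp
  then obtain i where i: "i \<in> S" "Poly_Mapping.lookup k i \<noteq> 0" by (auto simp: weight_def)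
  \<comment> \<open>One variable of \<open>S\<close> is split off from \<open>k\<close> and paired
    with one of the \<open>r\<close> copies of the complement monomial; this pair lies in
    \<open>I\<close>.\<close>
  define e where "e = Poly_Mapping.single i (1 :: nat)"
  have "\<exists>l. k = e + l"
    unfolding exponent_le_iff using i by (auto simp: e_def lookup_single when_def)
  then obtain l where l: "k = e + l" by blast
  have "weight S e = 1" using i(1) by (simp add: e_def weight_def lookup_single when_def)
  then have "r \<le> weight S l" using Suc.prems by (simp add: l weight_add)
  then have 1: "monom_of l * monom_of (complement_exponent S) ^ r \<in> ideal_power I r" by (rule Suc.IH)
  have "monom_of (e + complement_exponent S) \<in> I"
    using monom_of_complement_mem_I[OF S i(1), of e] by (simp add: e_def)
  from mult_ideal_power_Suc[OF 1 this] show ?case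
    by (simp add: l monom_of_add mult_ac)
qed

text \<open>The monomial case applied to each term. This provides the denominators showing that
  \<open>I\<close> and P_S have the same \<open>r\<close>-th power after localization at
  P_S.\<close>

lemma weight_ideal_mult_complement:
  assumes S: "S \<in> min_covers M" and f: "f \<in> weight_ideal S r"
  shows "monom_of (complement_exponent S) ^ r * f \<in> ideal_power I r"
proof -
  let ?u = "monom_of (complement_exponent S) ^ r :: ('n, 'k) mpoly"
  have J: "ideal (ideal_power I r) ring_of" by (rule ideal_ideal_power[OF ideal_I])
  have "(\<Sum>k\<in>K. Poly_Mapping.single k (Poly_Mapping.lookup f k) * ?u) \<in> ideal_power I r"
    if "finite K" "K \<subseteq> Poly_Mapping.keys f" for K
    using that
  proof (induction K rule: finite_induct)
    case empty
    then show ?case using J by (simp add: ideal_ring_of_iff)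
  next
    case (insert k K)
    then have "r \<le> weight S k" using f by (simp add: weight_ideal_def)
    then have "Poly_Mapping.single 0 (Poly_Mapping.lookup f k) * (monom_of k * ?u) \<in> ideal_power I r"
      using J monom_of_mult_complement_mem_ideal_power[OF S] unfolding ideal_ring_of_iff by blast
    then have "Poly_Mapping.single k (Poly_Mapping.lookup f k) * ?u \<in> ideal_power I r"
      by (simp add: monom_of_def mult_single flip: mult.assoc)
    then show ?case using insert J by (simp add: ideal_ring_of_iff)
  qed
  from this[of "Poly_Mapping.keys f"]
  have "(\<Sum>k\<in>Poly_Mapping.keys f. Poly_Mapping.single k (Poly_Mapping.lookup f k)) * ?u \<in> ideal_power I r"
    by (simp add: sum_distrib_right)
  then show ?thesis by (simp add: mult.commute flip: poly_mapping_sum_single)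
qed

text \<open>At each associated prime, the contraction is bounded above by cancelling a denominator
  outside P_S, and below by taking the \<open>r\<close>-th power of the complement monomial as
  denominator.\<close>

lemma symbolic_power_eq: "symbolic_power I r = (\<Inter>S\<in>min_covers M. weight_ideal S r)"
proof -
  have "localize_contract (weight_ideal S 1) (ideal_power I r) = (weight_ideal S r :: ('n, 'k) mpoly set)"
    if S: "S \<in> min_covers M" for S
  proof (intro equalityI subsetI)
    fix f assume "f \<in> localize_contract (weight_ideal S 1) (ideal_power I r)"
    then obtain g where g: "g \<notin> weight_ideal S 1" "g * f \<in> ideal_power I r"
      unfolding mem_localize_contract_iff[OF primeideal_weight_ideal ideal_ideal_power[OF ideal_I]]
      by blast
    have "I \<subseteq> weight_ideal S 1" using S unfolding I_subset_weight_ideal_iff by (simp add: min_covers_def)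
    from subsetD[OF ideal_power_weight_ideal[OF this] g(2)] show "f \<in> weight_ideal S r"
      by (rule weight_ideal_cancel[OF g(1)])
  next
    fix f :: "('n, 'k) mpoly" assume "f \<in> weight_ideal S r"
    then show "f \<in> localize_contract (weight_ideal S 1) (ideal_power I r)"
      unfolding mem_localize_contract_iff[OF primeideal_weight_ideal ideal_ideal_power[OF ideal_I]]
      using weight_ideal_mult_complement[OF S] complement_exponent_power_notin by blast
  qed
  then show ?thesis by (simp add: symbolic_power_def associated_primes_eq del: One_nat_def)
qed

section \<open>Values of the symbolic powers\<close>

lemma prime_valuation_weight_ideal:
  fixes f :: "('n, 'k) mpoly"
  assumes "f \<noteq> 0"
  shows "prime_valuation (weight_ideal S 1 :: ('n, 'k) mpoly set) (to_fract f) = real (min_weight (weight S) f)"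
proof -
  let ?v = "prime_valuation (weight_ideal S 1 :: ('n, 'k) mpoly set)"
  have monom: "?v (to_fract (monom_of k)) = real (weight S k)" for k
    by (simp only: prime_valuation(2) Var_mem_weight_ideal weight_def Collect_mem_eq)
  have "?v (to_fract f) = Min ((\<lambda>k. ?v (to_fract (monom_of k))) ` Poly_Mapping.keys f)"
    using prime_valuation(1)[of "weight_ideal S 1 :: ('n, 'k) mpoly set"] assms
    unfolding monomial_valuation_def by blast
  also have "\<dots> = Min (real ` weight S ` Poly_Mapping.keys f)"
    unfolding monom image_image ..
  also have "\<dots> = real (Min (weight S ` Poly_Mapping.keys f))"
    using assms by (intro mono_Min_commute[symmetric] monoI) auto
  finally show ?thesis by (simp only: min_weight_def)
qed

lemma min_weight_power:
  fixes f :: "('n, 'k) mpoly"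
  assumes "f \<noteq> 0"
  shows "min_weight (weight S) (f ^ r) = r * min_weight (weight S) f"
proof (induction r)
  case 0
  have "weight S 0 = 0" by (simp add: weight_def)
  then show ?case by (simp add: min_weight_def)
next
  case (Suc r)
  have "min_weight (weight S) (f * f ^ r) = min_weight (weight S) f + min_weight (weight S) (f ^ r)"
    by (rule min_weight_mult[OF weight_add]) (use assms in auto)
  with Suc show ?case by simp
qed

lemma ideal_value_symbolic_power:
  assumes S: "S \<in> min_covers M"
  shows "ideal_value (prime_valuation (weight_ideal S 1)) (symbolic_power I r) = real r"
  unfolding ideal_value_def
proof (rule cInf_eq_minimum)
  fix x assume "x \<in> (\<lambda>f. prime_valuation (weight_ideal S 1) (to_fract f)) ` (symbolic_power I r - {0})"
  then obtain f where f: "f \<in> symbolic_power I r" "f \<noteq> 0"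
    "x = prime_valuation (weight_ideal S 1) (to_fract f)" by blast
  then have "f \<in> weight_ideal S r" using S unfolding symbolic_power_eq by blast
  then show "real r \<le> x"
    unfolding f(3) prime_valuation_weight_ideal[OF f(2)] using f(2) by (simp add: mem_weight_ideal_iff)
next
  obtain m0 where "m0 \<in> M" using nonempty by blast
  then have "1 \<le> weight S m0" using S by (auto simp: min_covers_def vertex_cover_def)
  then obtain i where i: "i \<in> S" unfolding one_le_weight_iff by blast
  \<comment> \<open>The \<open>r\<close>-th power of a generator meeting \<open>S\<close> in a
    single variable lies in the ordinary power of \<open>I\<close> and attains the value
    \<open>r\<close>.\<close>
  obtain m where m: "m \<in> M" "weight S m = 1" using min_cover_witness[OF S i] by blast
  let ?f = "monom_of m :: ('n, 'k) mpoly"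
  have nz: "?f \<noteq> 0" by (rule monom_of_nonzero)
  have "1 * ?f ^ r \<in> ideal_power I (0 + r)"
    by (rule power_mult_ideal_power) (use monom_of_mem_I[OF m(1)] in \<open>simp_all add: ideal_power_0\<close>)
  moreover have "ideal_power I r \<subseteq> weight_ideal T r" if "T \<in> min_covers M" for T
    using that by (intro ideal_power_weight_ideal) (simp add: I_subset_weight_ideal_iff min_covers_def del: One_nat_def)
  ultimately have "?f ^ r \<in> symbolic_power I r"
    unfolding symbolic_power_eq by auto
  moreover have "prime_valuation (weight_ideal S 1) (to_fract (?f ^ r)) = real r"
  proof -
    have "min_weight (weight S) ?f = 1" using m(2) by (simp add: min_weight_def)
    then have "min_weight (weight S) (?f ^ r) = r" using min_weight_power[OF nz, of S r] by simp
    moreover have "?f ^ r \<noteq> 0" using nz by simp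
    ultimately show ?thesis by (metis prime_valuation_weight_ideal)
  qed
  moreover have "?f ^ r \<noteq> 0" using nz by simp
  ultimately show "real r \<in> (\<lambda>f. prime_valuation (weight_ideal S 1) (to_fract f)) ` (symbolic_power I r - {0})"
    by (metis (no_types, lifting) Diff_iff image_eqI singletonD)
qed

lemma asymptotic_value_symbolic_power:
  assumes S: "S \<in> min_covers M"
  shows "asymptotic_value (prime_valuation (weight_ideal S 1)) (symbolic_power I) = 1"
proof -
  \<comment> \<open>At \<open>r = 0\<close> the quotient is 0 / 0 = 0, so it equals 1 only from
    \<open>r = 1\<close> on.\<close>
  have "eventually (\<lambda>r. ideal_value (prime_valuation (weight_ideal S 1)) (symbolic_power I r) / real r = 1) sequentially"
    unfolding ideal_value_symbolic_power[OF S] using eventually_gt_at_top[of 0] by eventually_elim simp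
  then show ?thesis
    unfolding asymptotic_value_def by (intro limI tendsto_eventually)
qed

lemma prime_valuation_prod_Var:
  "prime_valuation (weight_ideal S 1 :: ('n, 'k) mpoly set) (to_fract (\<Prod>i\<in>UNIV. Var i)) = real (card S)"
proof -
  let ?k = "\<Sum>i\<in>UNIV. Poly_Mapping.single i (1::nat) :: 'n \<Rightarrow>\<^sub>0 nat"
  have "(\<Prod>i\<in>UNIV. Var i :: ('n, 'k) mpoly) = monom_of ?k"
    by (simp add: Var_def monom_of_sum)
  moreover have "Poly_Mapping.lookup ?k i = 1" for i
    by (simp add: lookup_sum lookup_single when_def)
  then have "min_weight (weight S) (monom_of ?k :: ('n, 'k) mpoly) = card S"
    by (simp add: min_weight_def weight_def)
  ultimately show ?thesis
    by (simp only: prime_valuation_weight_ideal[OF monom_of_nonzero])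
qed

section \<open>The least size of a minimal cover, the valuation ratios and the height\<close>

definition cover_number :: nat where
  "cover_number = Min (card ` min_covers M)"

lemma finite_min_covers: "finite (min_covers M)"
  by (rule finite_subset[of _ UNIV]) auto

lemma cover_number_le: "S \<in> min_covers M \<Longrightarrow> cover_number \<le> card S"
  unfolding cover_number_def using finite_min_covers by (intro Min_le) auto

lemma cover_number_attained:
  obtains S where "S \<in> min_covers M" "card S = cover_number"
proof -
  have "cover_number \<in> card ` min_covers M"
    unfolding cover_number_def using finite_min_covers min_covers_nonempty by (intro Min_in) auto
  then show ?thesis using that by auto
qed

lemma Min_valuation_ratio:
  "Min ((\<lambda>P. prime_valuation P (to_fract (\<Prod>i\<in>UNIV. Var i)) /
              asymptotic_value (prime_valuation P) (symbolic_power I)) ` minimal_primes I) = real cover_number"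
proof -
  have "(\<lambda>P. prime_valuation P (to_fract (\<Prod>i\<in>UNIV. Var i)) /
              asymptotic_value (prime_valuation P) (symbolic_power I)) ` minimal_primes I
      = real ` card ` min_covers M"
    unfolding minimal_primes_eq image_image
    by (rule image_cong)
       (simp_all only: prime_valuation_prod_Var asymptotic_value_symbolic_power div_by_1)
  also have "Min (real ` card ` min_covers M) = real (Min (card ` min_covers M))"
    using finite_min_covers min_covers_nonempty
    by (intro mono_Min_commute[symmetric] monoI) auto
  finally show ?thesis by (simp only: cover_number_def)
qed

text \<open>A smallest cover gives a prime over \<open>I\<close> of at most this height; conversely
  each prime over \<open>I\<close> contains some P_T, whose variables already yield a chain of |T|
  steps below that prime.\<close>

lemma height_eq: "height I = enat cover_number"
proof (rule antisym)
  obtain S where S: "S \<in> min_covers M" "card S = cover_number" using cover_number_attained .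
  have "I \<subseteq> weight_ideal S 1" unfolding I_subset_weight_ideal_iff using S by (simp add: min_covers_def)
  then have "height I \<le> prime_height (weight_ideal S 1 :: ('n, 'k) mpoly set)"
    unfolding height_def by (intro INF_lower) (simp add: primeideal_weight_ideal del: One_nat_def)
  also have "\<dots> \<le> enat cover_number" using prime_height_weight_ideal_le[of S] S(2) by simp
  finally show "height I \<le> enat cover_number" .
next
  show "enat cover_number \<le> height I"
    unfolding height_def
  proof (rule INF_greatest)
    fix P assume "P \<in> {P. primeideal P ring_of \<and> I \<subseteq> P}"
    then have P: "primeideal P ring_of" "I \<subseteq> P" by auto
    obtain T where T: "T \<in> min_covers M" "weight_ideal T 1 \<subseteq> P" using prime_contains_min_cover[OF P] .
    have "enat cover_number \<le> enat (card T)" using cover_number_le[OF T(1)] by simp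
    also have "\<dots> \<le> prime_height P" by (rule card_le_prime_height[OF P(1) T(2)])
    finally show "enat cover_number \<le> prime_height P" .
  qed
qed

section \<open>The threshold of the symbolic powers\<close>

lemma nu_max_symbolic_power:
  assumes q: "1 \<le> q"
  shows "nu_max (symbolic_power I) q = enat (cover_number * (q - 1))"
  unfolding nu_max_def
proof (rule antisym)
  show "(SUP r\<in>{r. \<not> symbolic_power I r \<subseteq> frobenius_power_max q}. enat r) \<le> enat (cover_number * (q - 1))"
  proof (rule SUP_least)
    fix r assume "r \<in> {r. \<not> symbolic_power I r \<subseteq> frobenius_power_max q}"
    then obtain f where f: "f \<in> symbolic_power I r" "f \<notin> frobenius_power_max q" by blast
    \<comment> \<open>A polynomial outside the Frobenius power has a term with all exponents at most
      \<open>q - 1\<close>; on a smallest cover this bounds its weight, and hence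
      \<open>r\<close>.\<close>
    then obtain k where k: "k \<in> Poly_Mapping.keys f" "\<And>i. Poly_Mapping.lookup k i < q"
      by (auto simp: mem_frobenius_power_max not_le)
    obtain S where S: "S \<in> min_covers M" "card S = cover_number" using cover_number_attained .
    have "f \<in> weight_ideal S r" using f(1) S(1) unfolding symbolic_power_eq by blast
    then have "r \<le> weight S k" using k(1) by (simp add: weight_ideal_def)
    also have "\<dots> \<le> (\<Sum>i\<in>S. q - 1)"
      unfolding weight_def
    proof (rule sum_mono)
      show "Poly_Mapping.lookup k i \<le> q - 1" for i using k(2)[of i] by linarith
    qed
    finally show "enat r \<le> enat (cover_number * (q - 1))" using S(2) by simp
  qed
next
  \<comment> \<open>The exponent of the (q-1)-th power of the product of all variables. Its weight
    on a cover \<open>S\<close> is |S| (q-1), and it lies outside the Frobenius power because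
    \<open>q \<ge> 1\<close> makes \<open>q - 1\<close> smaller than \<open>q\<close>.\<close>
  define k :: "'n \<Rightarrow>\<^sub>0 nat" where "k = (\<Sum>i\<in>UNIV. Poly_Mapping.single i (q - 1))"
  have lookup: "Poly_Mapping.lookup k i = q - 1" for i
    by (simp add: k_def lookup_sum lookup_single when_def)
  let ?f = "monom_of k :: ('n, 'k) mpoly"
  have "?f \<in> symbolic_power I (cover_number * (q - 1))"
    unfolding symbolic_power_eq
  proof
    fix S assume "S \<in> min_covers M"
    then have "cover_number * (q - 1) \<le> card S * (q - 1)" using cover_number_le by simp
    also have "\<dots> = weight S k" by (simp add: weight_def lookup)
    finally show "?f \<in> weight_ideal S (cover_number * (q - 1))" by (simp add: weight_ideal_def)
  qed
  moreover have "?f \<notin> frobenius_power_max q"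
    using q by (auto simp: mem_frobenius_power_max lookup)
  ultimately show "enat (cover_number * (q - 1)) \<le> (SUP r\<in>{r. \<not> symbolic_power I r \<subseteq> frobenius_power_max q}. enat r)"
    by (intro SUP_upper) blast
qed

lemma F_threshold_seq_tendsto:
  assumes p: "prime p"
  shows "F_threshold_seq p (symbolic_power I) \<longlonglongrightarrow> ereal (real cover_number)"
proof -
  have p1: "1 < p" using p by (rule prime_gt_1_nat)
  \<comment> \<open>The value h (q-1) divided by q = p^e differs from h by h / p^e, which tends to
    0.\<close>
  have eq: "F_threshold_seq p (symbolic_power I) e = ereal (real cover_number * (1 - inverse (real p ^ e)))" for e
  proof -
    have "1 \<le> p ^ e" using p1 by simp
    then have "F_threshold_seq p (symbolic_power I) e = ereal (real (cover_number * (p ^ e - 1)) / real (p ^ e))"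
      unfolding F_threshold_seq_def nu_max_symbolic_power[OF \<open>1 \<le> p ^ e\<close>] using p1 by simp
    also have "real (cover_number * (p ^ e - 1)) / real (p ^ e) = real cover_number * (1 - inverse (real p ^ e))"
      using \<open>1 \<le> p ^ e\<close> p1 by (simp add: of_nat_diff field_simps)
    finally show ?thesis .
  qed
  have "(\<lambda>e. inverse (real p ^ e)) \<longlonglongrightarrow> 0"
    using p1 by (intro LIMSEQ_inverse_realpow_zero) simp
  then have "(\<lambda>e. real cover_number * (1 - inverse (real p ^ e))) \<longlonglongrightarrow> real cover_number * (1 - 0)"
    by (intro tendsto_intros)
  then show ?thesis unfolding eq by simp
qed

end

theorem theorem6p16:
  fixes \<aa> :: "('n::{finite,linorder}, 'k::Fields.field) mpoly set" and p :: nat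
  assumes "prime p" and "CHAR('k) = p"
    and "squarefree_monomial_ideal \<aa>" and "\<aa> \<noteq> {0}" and "\<aa> \<noteq> UNIV"
  shows "convergent (F_threshold_seq p (symbolic_power \<aa>)) \<and>
    F_threshold p (symbolic_power \<aa>) =
      ereal (Min ((\<lambda>P. prime_valuation P (to_fract (\<Prod>i\<in>UNIV. Var i)) /
                       asymptotic_value (prime_valuation P) (symbolic_power \<aa>))
                  ` minimal_primes \<aa>)) \<and>
    ereal (Min ((\<lambda>P. prime_valuation P (to_fract (\<Prod>i\<in>UNIV. Var i)) /
                     asymptotic_value (prime_valuation P) (symbolic_power \<aa>))
                ` minimal_primes \<aa>)) = ereal_of_enat (height \<aa>)"
proof -
  obtain M where M: "\<And>m i. m \<in> M \<Longrightarrow> Poly_Mapping.lookup m i \<le> 1" "\<aa> = Idl\<^bsub>ring_of\<^esub> (monom_of ` M)"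
    using assms(3) unfolding squarefree_monomial_ideal_def by metis
  have "M \<noteq> {}"
  proof
    assume "M = {}"
    then have "\<aa> = {0}" unfolding M(2) Idl_monom_of by auto
    then show False using assms(4) by simp
  qed
  moreover have "0 \<notin> M"
  proof
    \<comment> \<open>The zero exponent gives the monomial 1, which divides every monomial.\<close>
    assume "0 \<in> M"
    then have "\<aa> = UNIV" unfolding M(2) Idl_monom_of by (auto intro!: bexI[of _ 0])
    then show False using assms(5) by simp
  qed
  ultimately interpret squarefree_exponents M \<aa>
    using M by unfold_locales
  have lim: "F_threshold_seq p (symbolic_power \<aa>) \<longlonglongrightarrow> ereal (real cover_number)"
    by (rule F_threshold_seq_tendsto[OF assms(1)])
  then have "convergent (F_threshold_seq p (symbolic_power \<aa>))" by (rule convergentI)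
  moreover have "F_threshold p (symbolic_power \<aa>) = ereal (real cover_number)"
    unfolding F_threshold_def using lim by (rule limI)
  ultimately show ?thesis
    unfolding Min_valuation_ratio height_eq by simp
qed

end
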